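(* Let $\mathbf{k}$ be a field, let $A$ be a finitely generated $\mathbf{k}$-algebra which is a domain, let $\mathcal{B}=\{b_1,\dots,b_n\}$ be a set of algebra generators of $A$, and let $I$ be the kernel of $\pi:\mathbf{k}[x_1,\dots,x_n]\to A$, $x_i\mapsto b_i$. Let $C\subset\mathcal{T}(I)$ be a prime cone. Let $\mathbf{u}=\{u_1,\dots,u_r\}\subset C$ be a collection of rational vectors that span a real vector space of maximal dimension $\dim(C)$. Let $M\in\mathbb{Q}^{r\times n}$ be the matrix whose rows are $u_1,\dots,u_r$, and let $\mathfrak{v}_M:A\setminus\{0\}\to\mathbb{Q}^r$ be the weight quasivaluation associated to $M$ (where $\mathbb{Q}^r$ carries the standard lexicographic ordering). Then $\mathfrak{v}_M$ is a valuation and the following hold: (1) $\mathrm{gr}_{\mathfrak{v}_M}(A)\cong\mathbf{k}[x_1,\dots,x_n]/\mathrm{in}_C(I)$. (2) $M$ coincides with the matrix whose $(i,j)$ entry is $\mathfrak{v}_{u_i}(b_j)$, $1\le i\le r$, $1\le j\le n$, where $\mathfrak{v}_{u_i}$ is the ($\mathbb{Q}$-valued) weight quasivaluation on $A$ associated to the weight vector $u_i$. (3) The value semigroup $S(A,\mathfrak{v}_M)$ is generated by the columns of $M$. (4) If $C$ lies in the Gröbner region $\mathrm{GR}(I)$, then $\mathfrak{v}_M$ has an adapted basis, which can be taken to be a standard monomial basis for a maximal cone in the Gröbner fan of $I$ containing $C$ (i.e. the standard monomial basis of a monomial ordering $>$ with $C\subset C_>(I)$).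
   Context: Initial ideals (min convention): for $u\in\mathbb{Q}^n$ and $p=\sum c_\alpha x^\alpha$, $\mathrm{in}_u(p)$ is the sum of the terms $c_\alpha x^\alpha$ ($c_\alpha\ne0$) with $u\cdot\alpha$ minimal; $\mathrm{in}_u(I)$ is generated by all $\mathrm{in}_u(p)$, $p\in I$. $\mathcal{T}(I)$ is the set of $u\in\mathbb{Q}^n$ such that $\mathrm{in}_u(I)$ contains no monomial. An open cone $C\subset\mathcal{T}(I)$ is a polyhedral cone equal to its relative interior, contained in $\mathcal{T}(I)$, such that $\mathrm{in}_u(I)$ is the same ideal $\mathrm{in}_C(I)$ for all $u\in C$. $C$ is a prime cone if $\mathrm{in}_C(I)$ is prime. Weight quasivaluations: let $\mathbb{Q}^r$ carry a group ordering $\succ$. For $M\in\mathbb{Q}^{r\times n}$ and $0\ne p=\sum c_\alpha x^\alpha$ put $\tilde{\mathfrak{v}}_M(p)=\min\{M\alpha\mid c_\alpha\neq0\}$, and for $0\ne f\in A$ put $\mathfrak{v}_M(f)=\max\{\tilde{\mathfrak{v}}_M(\tilde f)\mid\pi(\tilde f)=f\}$ ($\min$, $\max$ with respect to $\succ$). For $r=1$ and $u\in\mathbb{Q}^n$ this gives $\mathfrak{v}_u$. A quasivaluation satisfies $\mathfrak{v}(f+g)\succeq\min\{\mathfrak{v}(f),\mathfrak{v}(g)\}$, $\mathfrak{v}(fg)\succeq\mathfrak{v}(f)+\mathfrak{v}(g)$ and $\mathfrak{v}(cf)=\mathfrak{v}(f)$ for $0\ne c\in\mathbf{k}$; it is a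 valuation if moreover $\mathfrak{v}(fg)=\mathfrak{v}(f)+\mathfrak{v}(g)$ for all nonzero $f,g$. For a valuation $\mathfrak{v}$: $S(A,\mathfrak{v})=\{\mathfrak{v}(f)\mid0\ne f\in A\}$; $F_{\mathfrak{v}\succeq a}=\{f\ne0\mid\mathfrak{v}(f)\succeq a\}\cup\{0\}$, similarly $F_{\mathfrak{v}\succ a}$; $\mathrm{gr}_{\mathfrak{v}}(A)=\bigoplus_aF_{\mathfrak{v}\succeq a}/F_{\mathfrak{v}\succ a}$. A vector space basis $\mathbb{B}$ of $A$ is adapted to $\mathfrak{v}$ if $F_{\mathfrak{v}\succeq a}\cap\mathbb{B}$ is a basis of $F_{\mathfrak{v}\succeq a}$ for all $a$. Gröbner region: for a monomial ordering $>$ let $C_>(I)=\{u\in\mathbb{Q}^n\mid\mathrm{in}_>(\mathrm{in}_u(I))=\mathrm{in}_>(I)\}$; these are the maximal cones of the Gröbner fan of $I$. $\mathrm{GR}(I)$ is the union of the $C_>(I)$ over all monomial orderings. The standard monomial basis of $A$ for $>$ is the set of images in $A\cong\mathbf{k}[x_1,\dots,x_n]/I$ of the monomials not in $\mathrm{in}_>(I)$. *)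

theory Defs
  imports
    "HOL-Analysis.Analysis"
    "HOL-Library.Poly_Mapping"
    "HOL-Algebra.QuotRing"
    "HOL-Algebra.Algebraic_Closure_Type"
begin

text \<open>
  Exponent vectors are finitely supported functions on the finite index type \<open>'n\<close>; the
  polynomial ring in the variables \<open>x j\<close> (\<open>j :: 'n\<close>) over \<open>'k\<close> is the convolution ring
  on finitely supported functions on exponent vectors.
\<close>

type_synonym 'n expo = "'n \<Rightarrow>\<^sub>0 nat"
type_synonym ('n, 'k) mpol = "'n expo \<Rightarrow>\<^sub>0 'k"

locale k_algebra = vector_space smul
  for smul :: "'k::field \<Rightarrow> 'a::comm_ring_1 \<Rightarrow> 'a" +
  assumes smul_mult_left: "smul c x * y = smul c (x * y)"

definition is_subalgebra :: "('k \<Rightarrow> 'a::comm_ring_1 \<Rightarrow> 'a) \<Rightarrow> 'a set \<Rightarrow> bool" where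
  "is_subalgebra smul S \<longleftrightarrow> 1 \<in> S \<and> (\<forall>x\<in>S. \<forall>y\<in>S. x + y \<in> S \<and> x * y \<in> S) \<and> (\<forall>c. \<forall>x\<in>S. smul c x \<in> S)"

definition algebra_generators :: "('k \<Rightarrow> 'a::comm_ring_1 \<Rightarrow> 'a) \<Rightarrow> 'a set \<Rightarrow> bool" where
  "algebra_generators smul B \<longleftrightarrow> is_subalgebra smul hull B = UNIV"

abbreviation monomial :: "'n expo \<Rightarrow> ('n, 'k::field) mpol" where
  "monomial \<alpha> \<equiv> Poly_Mapping.single \<alpha> 1"

abbreviation const_pol :: "'k::field \<Rightarrow> ('n, 'k) mpol" where
  "const_pol c \<equiv> Poly_Mapping.single 0 c"

abbreviation mpol_ring :: "('n, 'k::field) mpol ring" where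
  "mpol_ring \<equiv> ring_of_type_algebra"

definition eval_hom ::
  "('k::field \<Rightarrow> 'a::comm_ring_1 \<Rightarrow> 'a) \<Rightarrow> ('n::finite \<Rightarrow> 'a) \<Rightarrow> ('n, 'k) mpol \<Rightarrow> 'a" where
  "eval_hom smul b p =
     (\<Sum>\<alpha>\<in>Poly_Mapping.keys p.
        smul (Poly_Mapping.lookup p \<alpha>) (\<Prod>j\<in>UNIV. b j ^ Poly_Mapping.lookup \<alpha> j))"

definition kernel_ideal ::
  "('k::field \<Rightarrow> 'a::comm_ring_1 \<Rightarrow> 'a) \<Rightarrow> ('n::finite \<Rightarrow> 'a) \<Rightarrow> ('n, 'k) mpol set" where
  "kernel_ideal smul b = {p. eval_hom smul b p = 0}"

definition expo_vec :: "'n::finite expo \<Rightarrow> rat ^ 'n" where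
  "expo_vec \<alpha> = (\<chi> j. of_nat (Poly_Mapping.lookup \<alpha> j))"

definition weight :: "rat ^ 'n::finite \<Rightarrow> 'n expo \<Rightarrow> rat" where
  "weight u \<alpha> = (\<Sum>j\<in>UNIV. u $ j * expo_vec \<alpha> $ j)"

definition init_form :: "rat ^ 'n::finite \<Rightarrow> ('n, 'k::field) mpol \<Rightarrow> ('n, 'k) mpol" where
  "init_form u p =
     (\<Sum>\<alpha> | \<alpha> \<in> Poly_Mapping.keys p \<and> (\<forall>\<beta>\<in>Poly_Mapping.keys p. weight u \<alpha> \<le> weight u \<beta>).
        Poly_Mapping.single \<alpha> (Poly_Mapping.lookup p \<alpha>))"

definition init_ideal :: "rat ^ 'n::finite \<Rightarrow> ('n, 'k::field) mpol set \<Rightarrow> ('n, 'k) mpol set" where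
  "init_ideal u I = Idl\<^bsub>mpol_ring\<^esub> (init_form u ` I)"

definition trop :: "('n::finite, 'k::field) mpol set \<Rightarrow> (rat ^ 'n) set" where
  "trop I = {u. \<forall>\<alpha>. monomial \<alpha> \<notin> init_ideal u I}"

definition real_vec :: "rat ^ 'n::finite \<Rightarrow> real ^ 'n" where
  "real_vec u = (\<chi> j. of_rat (u $ j))"

text \<open>
  Relatively open polyhedral cones in the rational vector space are the sets of rational points
  of the relative interior of a rational polyhedral cone in real space. In particular they are
  nonempty.
\<close>

definition rel_open_cone :: "(rat ^ 'n::finite) set \<Rightarrow> bool" where
  "rel_open_cone C \<longleftrightarrow>
     (\<exists>F. finite F \<and> C = {u. real_vec u \<in> rel_interior {x. \<forall>a\<in>F. real_vec a \<bullet> x \<ge> 0}})"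

definition open_cone :: "('n::finite, 'k::field) mpol set \<Rightarrow> (rat ^ 'n) set \<Rightarrow> bool" where
  "open_cone I C \<longleftrightarrow>
     rel_open_cone C \<and> C \<subseteq> trop I \<and> (\<forall>u\<in>C. \<forall>u'\<in>C. init_ideal u I = init_ideal u' I)"

definition cone_init_ideal ::
  "(rat ^ 'n::finite) set \<Rightarrow> ('n, 'k::field) mpol set \<Rightarrow> ('n, 'k) mpol set" where
  "cone_init_ideal C I = (THE J. \<forall>u\<in>C. init_ideal u I = J)"

definition prime_cone :: "('n::finite, 'k::field) mpol set \<Rightarrow> (rat ^ 'n) set \<Rightarrow> bool" where
  "prime_cone I C \<longleftrightarrow> open_cone I C \<and> primeideal (cone_init_ideal C I) mpol_ring"

definition quasivaluation ::
  "('k::field \<Rightarrow> 'a::comm_ring_1 \<Rightarrow> 'a) \<Rightarrow> ('a \<Rightarrow> 'g::linordered_ab_group_add) \<Rightarrow> bool" where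
  "quasivaluation smul v \<longleftrightarrow>
     (\<forall>f g. f \<noteq> 0 \<and> g \<noteq> 0 \<and> f + g \<noteq> 0 \<longrightarrow> v (f + g) \<ge> min (v f) (v g)) \<and>
     (\<forall>f g. f \<noteq> 0 \<and> g \<noteq> 0 \<and> f * g \<noteq> 0 \<longrightarrow> v (f * g) \<ge> v f + v g) \<and>
     (\<forall>c f. c \<noteq> 0 \<and> f \<noteq> 0 \<longrightarrow> v (smul c f) = v f)"

definition valuation ::
  "('k::field \<Rightarrow> 'a::idom \<Rightarrow> 'a) \<Rightarrow> ('a \<Rightarrow> 'g::linordered_ab_group_add) \<Rightarrow> bool" where
  "valuation smul v \<longleftrightarrow>
     quasivaluation smul v \<and> (\<forall>f g. f \<noteq> 0 \<and> g \<noteq> 0 \<longrightarrow> v (f * g) = v f + v g)"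

definition value_semigroup :: "('a::zero \<Rightarrow> 'g) \<Rightarrow> 'g set" where
  "value_semigroup v = {v f | f. f \<noteq> 0}"

definition filt_ge :: "('a::zero \<Rightarrow> 'g::ord) \<Rightarrow> 'g \<Rightarrow> 'a set" where
  "filt_ge v a = {f. f \<noteq> 0 \<and> v f \<ge> a} \<union> {0}"

definition filt_gt :: "('a::zero \<Rightarrow> 'g::ord) \<Rightarrow> 'g \<Rightarrow> 'a set" where
  "filt_gt v a = {f. f \<noteq> 0 \<and> v f > a} \<union> {0}"

text \<open>
  An element of the associated graded ring is a family \<open>\<xi>\<close> of cosets \<open>\<xi> a\<close> in
  \<open>filt_ge v a / filt_gt v a\<close>, almost all of them zero. Sums and products of sets are taken
  elementwise, and the summand \<open>filt_gt v c\<close> fills up the product of two cosets (and the empty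
  sum) to a full coset.
\<close>

definition assoc_graded ::
  "('a::comm_ring_1 \<Rightarrow> 'g::linordered_ab_group_add) \<Rightarrow> ('g \<Rightarrow> 'a set) ring" where
  "assoc_graded v = \<lparr>
     carrier = {\<xi>. (\<forall>a. \<exists>f\<in>filt_ge v a. \<xi> a = f +o filt_gt v a) \<and> finite {a. \<xi> a \<noteq> filt_gt v a}},
     monoid.mult = (\<lambda>\<xi> \<eta> c.
       (\<Sum>(a, b)\<in>{(a, b). \<xi> a \<noteq> filt_gt v a \<and> \<eta> b \<noteq> filt_gt v b \<and> a + b = c}. \<xi> a * \<eta> b)
         + filt_gt v c),
     one = (\<lambda>a. if a = 0 then 1 +o filt_gt v 0 else filt_gt v a),
     ring.zero = (\<lambda>a. filt_gt v a),
     add = (\<lambda>\<xi> \<eta> a. \<xi> a + \<eta> a)\<rparr>"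

definition graded_const ::
  "('k::field \<Rightarrow> 'a::comm_ring_1 \<Rightarrow> 'a) \<Rightarrow> ('a \<Rightarrow> 'g::linordered_ab_group_add) \<Rightarrow> 'k \<Rightarrow> 'g \<Rightarrow> 'a set" where
  "graded_const smul v c = (\<lambda>a. if a = 0 then smul c 1 +o filt_gt v 0 else filt_gt v a)"

definition basis_of :: "('k::field \<Rightarrow> 'a::comm_ring_1 \<Rightarrow> 'a) \<Rightarrow> 'a set \<Rightarrow> 'a set \<Rightarrow> bool" where
  "basis_of smul B V \<longleftrightarrow>
     \<not> Modules.module.dependent smul B \<and> Modules.module.span smul B = V"

definition adapted_basis ::
  "('k::field \<Rightarrow> 'a::comm_ring_1 \<Rightarrow> 'a) \<Rightarrow> ('a \<Rightarrow> 'g::linordered_ab_group_add) \<Rightarrow> 'a set \<Rightarrow> bool" where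
  "adapted_basis smul v B \<longleftrightarrow>
     basis_of smul B UNIV \<and> (\<forall>a. basis_of smul (filt_ge v a \<inter> B) (filt_ge v a))"

text \<open>
  The weight \<open>w \<alpha>\<close> of an exponent vector takes values in a linear order: the rationals for a
  weight vector \<open>u\<close> (\<open>w = weight u\<close>), and the rational vectors with the lexicographic order for
  a matrix (\<open>w = mat_weight M\<close>). The order and addition on \<open>'r \<Rightarrow>\<^sub>0 rat\<close> are those of the library,
  namely lexicographic (smallest index first) and pointwise.
\<close>

definition lex_vec :: "rat ^ 'r::{finite,linorder} \<Rightarrow> ('r \<Rightarrow>\<^sub>0 rat)" where
  "lex_vec x = Abs_poly_mapping (\<lambda>i. x $ i)"

definition mat_weight ::
  "rat ^ 'n::finite ^ 'r::{finite,linorder} \<Rightarrow> 'n expo \<Rightarrow> ('r \<Rightarrow>\<^sub>0 rat)" where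
  "mat_weight M \<alpha> = lex_vec (M *v expo_vec \<alpha>)"

definition pol_qval :: "('n expo \<Rightarrow> 'g::linorder) \<Rightarrow> ('n, 'k::field) mpol \<Rightarrow> 'g" where
  "pol_qval w p = Min (w ` Poly_Mapping.keys p)"

definition weight_qval ::
  "('k::field \<Rightarrow> 'a::comm_ring_1 \<Rightarrow> 'a) \<Rightarrow> ('n::finite \<Rightarrow> 'a) \<Rightarrow> ('n expo \<Rightarrow> 'g::linorder) \<Rightarrow> 'a \<Rightarrow> 'g" where
  "weight_qval smul b w f = (GREATEST m. \<exists>p. eval_hom smul b p = f \<and> m = pol_qval w p)"

text \<open>
  \<open>weight_qval\<close> is meaningful only where the maximum is attained; for weights of mixed signs this
  is not automatic, so it is expressed separately.
\<close>

definition weight_qval_defined ::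
  "('k::field \<Rightarrow> 'a::comm_ring_1 \<Rightarrow> 'a) \<Rightarrow> ('n::finite \<Rightarrow> 'a) \<Rightarrow> ('n expo \<Rightarrow> 'g::linorder) \<Rightarrow> bool" where
  "weight_qval_defined smul b w \<longleftrightarrow>
     (\<forall>f. f \<noteq> 0 \<longrightarrow>
        (\<exists>p. eval_hom smul b p = f \<and>
             (\<forall>q. eval_hom smul b q = f \<longrightarrow> pol_qval w q \<le> pol_qval w p)))"

definition add_submonoid :: "'g::comm_monoid_add set \<Rightarrow> bool" where
  "add_submonoid S \<longleftrightarrow> 0 \<in> S \<and> (\<forall>x\<in>S. \<forall>y\<in>S. x + y \<in> S)"

text \<open>\<open>prec \<alpha> \<beta>\<close> means that \<open>\<beta>\<close> is strictly larger; leading terms are the largest ones.\<close>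

definition monomial_ordering :: "('n expo \<Rightarrow> 'n expo \<Rightarrow> bool) \<Rightarrow> bool" where
  "monomial_ordering prec \<longleftrightarrow>
     irreflp prec \<and> transp prec \<and> totalp prec \<and> wfp prec \<and>
     (\<forall>\<alpha> \<beta> \<gamma>. prec \<alpha> \<beta> \<longrightarrow> prec (\<alpha> + \<gamma>) (\<beta> + \<gamma>))"

definition lead_term ::
  "('n expo \<Rightarrow> 'n expo \<Rightarrow> bool) \<Rightarrow> ('n, 'k::field) mpol \<Rightarrow> ('n, 'k) mpol" where
  "lead_term prec p =
     (\<Sum>\<alpha> | \<alpha> \<in> Poly_Mapping.keys p \<and> (\<forall>\<beta>\<in>Poly_Mapping.keys p. \<beta> \<noteq> \<alpha> \<longrightarrow> prec \<beta> \<alpha>).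
        Poly_Mapping.single \<alpha> (Poly_Mapping.lookup p \<alpha>))"

definition lead_ideal ::
  "('n expo \<Rightarrow> 'n expo \<Rightarrow> bool) \<Rightarrow> ('n, 'k::field) mpol set \<Rightarrow> ('n, 'k) mpol set" where
  "lead_ideal prec I = Idl\<^bsub>mpol_ring\<^esub> (lead_term prec ` I)"

definition groebner_cone ::
  "('n::finite expo \<Rightarrow> 'n expo \<Rightarrow> bool) \<Rightarrow> ('n, 'k::field) mpol set \<Rightarrow> (rat ^ 'n) set" where
  "groebner_cone prec I = {u. lead_ideal prec (init_ideal u I) = lead_ideal prec I}"

definition groebner_region :: "('n::finite, 'k::field) mpol set \<Rightarrow> (rat ^ 'n) set" where
  "groebner_region I = (\<Union>prec\<in>{prec. monomial_ordering prec}. groebner_cone prec I)"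

definition standard_monomials ::
  "('k::field \<Rightarrow> 'a::comm_ring_1 \<Rightarrow> 'a) \<Rightarrow> ('n::finite \<Rightarrow> 'a) \<Rightarrow>
   ('n expo \<Rightarrow> 'n expo \<Rightarrow> bool) \<Rightarrow> 'a set" where
  "standard_monomials smul b prec =
     {eval_hom smul b (monomial \<alpha>) | \<alpha>.
        (monomial \<alpha> :: ('n, 'k) mpol) \<notin> lead_ideal prec (kernel_ideal smul b)}"

end

theory Submission
  imports Defs
begin

text \<open>
  Let \<open>J\<close> be the common initial ideal of the vectors of the cone, and let \<open>w\<close>
  be a weight, of rank one or lexicographic, whose initial ideal is \<open>J\<close>. The key is the
  notion of a detecting representative of \<open>f \<noteq> 0\<close>: a polynomial
  \<open>p\<close> with image \<open>f\<close> whose initial form lies outside \<open>J\<close>.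
  Its weight is the value of \<open>f\<close>, for a representative of larger weight would differ
  from \<open>p\<close> by a relation with the same initial form as \<open>p\<close>
  (\<open>detecting_optimal\<close>). Once every \<open>f \<noteq> 0\<close> has a detecting
  representative, the theorem unfolds as follows.

  \<^item> Initial forms are multiplicative and \<open>J\<close> is prime, so products of detecting
    representatives are detecting and \<open>v\<close> is a valuation (\<open>weight_qval_mult\<close>).
  \<^item> \<open>J\<close> contains no monomial, so the value of a monomial is its weight. For the
    rank one weights this gives the entries of the matrix, and for the lexicographic weight the
    value semigroup (\<open>value_semigroup_eq_range\<close>).
  \<^item> A polynomial that is homogeneous of weight \<open>a\<close> vanishes in the associated
    graded ring if and only if it is the initial form of a relation, so the graded ring is the
    quotient by \<open>J\<close> (\<open>gr_class_kernel\<close>, \<open>assoc_graded_iso\<close>).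
  \<^item> If \<open>J\<close> and \<open>I\<close> have the same leading ideal, a nonzero combination
    of standard monomials is detecting, so the filtration can be read off from normal forms
    (\<open>adapted_basis_standard_monomials\<close>).

  Two points remain. The lexicographic weight of the matrix has initial ideal \<open>J\<close> too:
  \<open>J\<close> is homogeneous for every row, and an element that is homogeneous for all rows and is an
  initial form for the first row is an initial form for the matrix
  (\<open>graded_init_ideal_mat_weight\<close>).

  The other point is the existence of detecting representatives. For a vector \<open>u\<close> of the
  cone, an element without one would have representatives of arbitrarily large weight. Krull's
  intersection theorem for the Rees algebra of the filtration excludes this; the argument is carried
  out with elements (\<open>no_infinite_value\<close>) on the basis of a graded version of Hilbert's
  basis theorem (\<open>graded_hilbert_basis\<close>), which follows from Dickson's lemma. For the matrix,
  a representative that detects \<open>f\<close> for the first row is corrected by a relation that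
  removes the components of its initial form lying in \<open>J\<close>
  (\<open>detecting_representative_mat_weight\<close>).
\<close>

section \<open>Polynomials and ideals\<close>

lemma mpol_expand: "p = (\<Sum>\<alpha>\<in>Poly_Mapping.keys p. Poly_Mapping.single \<alpha> (Poly_Mapping.lookup p \<alpha>))"
  by (rule poly_mapping_eqI)
    (simp add: lookup_sum lookup_single when_def in_keys_iff)

lemma mpol_induct [case_names zero single add]:
  fixes p :: "('n, 'k::field) mpol"
  assumes "P 0" and "\<And>\<alpha> c. P (Poly_Mapping.single \<alpha> c)" and "\<And>p q. P p \<Longrightarrow> P q \<Longrightarrow> P (p + q)"
  shows "P p"
proof -
  have "P (\<Sum>\<alpha>\<in>K. Poly_Mapping.single \<alpha> (Poly_Mapping.lookup p \<alpha>))" if "finite K" for K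
    using that by (induction K) (simp_all add: assms)
  then show ?thesis
    using mpol_expand[of p] by (metis finite_keys)
qed

lemma ideal_ring_of_type_algebra_iff:
  fixes I :: "'r::comm_ring_1 set"
  shows "ideal I ring_of_type_algebra \<longleftrightarrow>
    0 \<in> I \<and> (\<forall>x\<in>I. \<forall>y\<in>I. x + y \<in> I) \<and> (\<forall>x\<in>I. \<forall>r. r * x \<in> I)"
  (is "ideal I ?R \<longleftrightarrow> ?rhs")
proof
  assume "ideal I ?R"
  then interpret ideal I ?R .
  show ?rhs
    using additive_subgroup.zero_closed[OF is_additive_subgroup]
      additive_subgroup.a_closed[OF is_additive_subgroup] I_l_closed
    by (auto simp: ring_of_type_algebra_def)
next
  assume rhs: ?rhs
  have neg: "- x \<in> I" if "x \<in> I" for x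
    using rhs that by (metis mult_minus1)
  interpret cring ?R by (rule cring_from_type_algebra)
  have ainv: "\<ominus>\<^bsub>?R\<^esub> x = - x" for x
    by (rule minus_equality) (auto simp: ring_of_type_algebra_def)
  show "ideal I ?R"
  proof (rule idealI[OF ring_axioms])
    show "subgroup I (add_monoid ?R)"
    proof (rule add.subgroupI)
      show "I \<noteq> {}"
        using rhs by blast
      show "\<ominus>\<^bsub>?R\<^esub> x \<in> I" if "x \<in> I" for x
        using neg[OF that] ainv[of x] by simp
    qed (use rhs in \<open>auto simp: ring_of_type_algebra_def\<close>)
  qed (use rhs in \<open>auto simp: ring_of_type_algebra_def mult.commute\<close>)
qed

lemma is_ideal_zero: "ideal I ring_of_type_algebra \<Longrightarrow> (0::'r::comm_ring_1) \<in> I"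
  and is_ideal_add: "ideal I ring_of_type_algebra \<Longrightarrow> x \<in> I \<Longrightarrow> y \<in> I \<Longrightarrow> x + y \<in> (I::'r set)"
  and is_ideal_mult: "ideal I ring_of_type_algebra \<Longrightarrow> x \<in> I \<Longrightarrow> r * x \<in> (I::'r set)"
  unfolding ideal_ring_of_type_algebra_iff by auto

lemma is_ideal_sum:
  assumes "ideal I ring_of_type_algebra" and "\<And>s. s \<in> S \<Longrightarrow> f s \<in> I"
  shows "sum f S \<in> (I::'r::comm_ring_1 set)"
  using assms(2)
  by (induction S rule: infinite_finite_induct)
    (auto simp: is_ideal_zero[OF assms(1)] intro: is_ideal_add[OF assms(1)])

text \<open>
  Cosets as plain sets of differences, so that an element of the quotient ring can be recognised
  as a fibre of a map.
\<close>

lemma coset_ring_of_type_algebra: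
  "I +>\<^bsub>ring_of_type_algebra\<^esub> x = {y::'r::comm_ring_1. y - x \<in> I}"
  by (auto simp: a_r_coset_def' ring_of_type_algebra_def algebra_simps intro!: bexI[of _ "_ - x"])

lemma genideal_ring_of_type_algebra:
  fixes S :: "'r::comm_ring_1 set"
  shows "ideal (Idl\<^bsub>ring_of_type_algebra\<^esub> S) ring_of_type_algebra"
    and "S \<subseteq> Idl\<^bsub>ring_of_type_algebra\<^esub> S"
    and "ideal J ring_of_type_algebra \<Longrightarrow> S \<subseteq> J \<Longrightarrow> Idl\<^bsub>ring_of_type_algebra\<^esub> S \<subseteq> J"
proof -
  interpret cring "ring_of_type_algebra :: 'r ring" by (rule cring_from_type_algebra)
  have S: "S \<subseteq> carrier ring_of_type_algebra"
    by (simp add: ring_of_type_algebra_def)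
  show "ideal (Idl\<^bsub>ring_of_type_algebra\<^esub> S) ring_of_type_algebra"
    using genideal_ideal[OF S] .
  show "S \<subseteq> Idl\<^bsub>ring_of_type_algebra\<^esub> S"
    using genideal_self[OF S] .
  show "Idl\<^bsub>ring_of_type_algebra\<^esub> S \<subseteq> J" if "ideal J ring_of_type_algebra" "S \<subseteq> J"
    using genideal_minimal[OF that] .
qed

section \<open>Dickson's lemma and monomial orderings\<close>

text \<open>
  A monotone subsequence exists in every linear order; a decreasing one is eventually constant
  in the natural numbers, so after a shift it is increasing as well.
\<close>

lemma nat_seq_incseq_subseq:
  fixes s :: "nat \<Rightarrow> nat"
  obtains r where "strict_mono r" "incseq (s \<circ> r)"
proof -
  obtain r where r: "strict_mono r" "monoseq (\<lambda>n. s (r n))"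
    using seq_monosub by blast
  show ?thesis
  proof (cases "incseq (\<lambda>n. s (r n))")
    case True
    with r that[of r] show ?thesis by (simp add: comp_def)
  next
    case False
    with r(2) have dec: "decseq (\<lambda>n. s (r n))"
      by (auto simp: monoseq_iff)
    obtain N where N: "\<And>n. s (r N) \<le> s (r n)"
      using ex_has_least_nat[of "\<lambda>_. True" 0 "\<lambda>n. s (r n)"] by auto
    have "s (r (n + N)) = s (r N)" for n
      using dec N[of "n + N"] by (metis decseqD le_add2 order_antisym)
    with r(1) that[of "\<lambda>n. r (n + N)"] show ?thesis
      by (simp add: comp_def strict_mono_def incseq_def)
  qed
qed

lemma dickson_subseq:
  fixes s :: "nat \<Rightarrow> 'i \<Rightarrow> nat"
  assumes "finite S"
  obtains r where "strict_mono r" "\<And>i. i \<in> S \<Longrightarrow> incseq (\<lambda>n. s (r n) i)"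
proof -
  from assms have "\<exists>r. strict_mono r \<and> (\<forall>i\<in>S. incseq (\<lambda>n. s (r n) i))"
  proof (induction S)
    case empty
    show ?case by (auto intro!: exI[of _ id] strict_mono_id)
  next
    case (insert x S)
    then obtain r where r: "strict_mono r" "\<forall>i\<in>S. incseq (\<lambda>n. s (r n) i)" by blast
    obtain t where t: "strict_mono t" "incseq ((\<lambda>n. s (r n) x) \<circ> t)"
      using nat_seq_incseq_subseq .
    have "strict_mono (r \<circ> t)"
      using r(1) t(1) by (rule strict_mono_o)
    moreover have "incseq (\<lambda>n. s ((r \<circ> t) n) i)" if "i \<in> insert x S" for i
      using that t r(2) by (auto simp: incseq_def comp_def strict_mono_less_eq)
    ultimately show ?case by blast
  qed
  with that show ?thesis by blast
qed

text \<open>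
  Dickson's lemma in the form of a good pair. The extra coordinate \<open>e\<close> will hold
  the exponent of a homogenizing variable.
\<close>

lemma dickson_good_pair:
  fixes \<alpha> :: "nat \<Rightarrow> 'n::finite expo" and e :: "nat \<Rightarrow> nat"
  obtains i j where "i < j" "\<And>k. Poly_Mapping.lookup (\<alpha> i) k \<le> Poly_Mapping.lookup (\<alpha> j) k" "e i \<le> e j"
proof -
  define s where "s n x = (case x of None \<Rightarrow> e n | Some k \<Rightarrow> Poly_Mapping.lookup (\<alpha> n) k)" for n x
  obtain r where r: "strict_mono r" "\<And>x. x \<in> UNIV \<Longrightarrow> incseq (\<lambda>n. s (r n) x)"
    using dickson_subseq[of UNIV s] by auto
  show ?thesis
  proof (rule that)
    show "r 0 < r 1"
      using r(1) by (simp add: strict_mono_def)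
    show "e (r 0) \<le> e (r 1)"
      using r(2)[of None] by (simp add: incseq_def s_def)
    show "Poly_Mapping.lookup (\<alpha> (r 0)) k \<le> Poly_Mapping.lookup (\<alpha> (r 1)) k" for k
      using r(2)[of "Some k"] by (simp add: incseq_def s_def)
  qed
qed

text \<open>
  The lexicographic ordering along an enumeration of the variables. It is well-founded because an
  infinite descent would contain a pair that Dickson's lemma orders the other way.
\<close>

lemma monomial_ordering_exists: "\<exists>prec :: 'n::finite expo \<Rightarrow> 'n expo \<Rightarrow> bool. monomial_ordering prec"
proof -
  obtain e :: "'n \<Rightarrow> nat" where e: "inj e"
    using finite_imp_inj_to_nat_seg[of "UNIV :: 'n set"] by auto
  define prec :: "'n expo \<Rightarrow> 'n expo \<Rightarrow> bool" where
    "prec \<alpha> \<beta> \<longleftrightarrow> (\<exists>j. Poly_Mapping.lookup \<alpha> j < Poly_Mapping.lookup \<beta> j \<and>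
       (\<forall>i. e i < e j \<longrightarrow> Poly_Mapping.lookup \<alpha> i = Poly_Mapping.lookup \<beta> i))" for \<alpha> \<beta>
  have irr: "irreflp prec"
    by (auto simp: irreflp_def prec_def)
  have trans: "transp prec"
  proof (rule transpI)
    fix \<alpha> \<beta> \<gamma> assume "prec \<alpha> \<beta>" "prec \<beta> \<gamma>"
    then obtain j k where
      j: "Poly_Mapping.lookup \<alpha> j < Poly_Mapping.lookup \<beta> j"
        "\<And>i. e i < e j \<Longrightarrow> Poly_Mapping.lookup \<alpha> i = Poly_Mapping.lookup \<beta> i" and
      k: "Poly_Mapping.lookup \<beta> k < Poly_Mapping.lookup \<gamma> k"
        "\<And>i. e i < e k \<Longrightarrow> Poly_Mapping.lookup \<beta> i = Poly_Mapping.lookup \<gamma> i"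
      unfolding prec_def by auto
    have "e j = e k \<Longrightarrow> j = k"
      using e by (simp add: inj_def)
    then consider "e j < e k" | "e k < e j" | "j = k"
      by linarith
    then show "prec \<alpha> \<gamma>"
    proof cases
      case 1
      with j k(2)[of j] show ?thesis
        unfolding prec_def by (intro exI[of _ j]) (auto simp: k(2))
    next
      case 2
      with k j(2)[of k] show ?thesis
        unfolding prec_def by (intro exI[of _ k]) (auto simp: j(2))
    next
      case 3
      with j k show ?thesis
        unfolding prec_def by (intro exI[of _ k]) auto
    qed
  qed
  have tot: "totalp prec"
  proof (rule totalpI)
    fix \<alpha> \<beta> :: "'n expo" assume "\<alpha> \<noteq> \<beta>"
    then obtain j0 where j0: "Poly_Mapping.lookup \<alpha> j0 \<noteq> Poly_Mapping.lookup \<beta> j0"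
      by (auto simp: poly_mapping_eq_iff fun_eq_iff)
    obtain j where "Poly_Mapping.lookup \<alpha> j \<noteq> Poly_Mapping.lookup \<beta> j"
      and "\<And>i. Poly_Mapping.lookup \<alpha> i \<noteq> Poly_Mapping.lookup \<beta> i \<Longrightarrow> e j \<le> e i"
      using ex_has_least_nat[of "\<lambda>j. Poly_Mapping.lookup \<alpha> j \<noteq> Poly_Mapping.lookup \<beta> j" j0 e] j0
      by blast
    then have "Poly_Mapping.lookup \<alpha> j < Poly_Mapping.lookup \<beta> j \<or> Poly_Mapping.lookup \<beta> j < Poly_Mapping.lookup \<alpha> j"
      and "\<forall>i. e i < e j \<longrightarrow> Poly_Mapping.lookup \<alpha> i = Poly_Mapping.lookup \<beta> i"
      by (auto simp: not_le[symmetric])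
    then show "prec \<alpha> \<beta> \<or> prec \<beta> \<alpha>"
      unfolding prec_def by auto
  qed
  have wf: "wfp prec"
    unfolding wfp_def wf_iff_no_infinite_down_chain
  proof (rule notI, elim exE)
    fix f :: "nat \<Rightarrow> 'n expo"
    assume "\<forall>i. (f (Suc i), f i) \<in> {(x, y). prec x y}"
    then have step: "prec (f (Suc i)) (f i)" for i by simp
    have desc: "prec (f (i + Suc d)) (f i)" for i d
    proof (induction d)
      case 0
      show ?case using step by simp
    next
      case (Suc d)
      from step[of "i + Suc d"] Suc trans show ?case
        by (metis add_Suc_right transpD)
    qed
    obtain i j where "i < j" and le: "\<And>k. Poly_Mapping.lookup (f i) k \<le> Poly_Mapping.lookup (f j) k"
      using dickson_good_pair[of f "\<lambda>_. 0"] by auto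
    then have "prec (f j) (f i)"
      using desc by (metis less_iff_Suc_add add_Suc_right)
    then show False
      unfolding prec_def using le by (meson not_le)
  qed
  have "prec (\<alpha> + \<gamma>) (\<beta> + \<gamma>)" if "prec \<alpha> \<beta>" for \<alpha> \<beta> \<gamma>
    using that by (auto simp: prec_def lookup_add)
  with irr trans tot wf have "monomial_ordering prec"
    by (simp add: monomial_ordering_def)
  then show ?thesis by blast
qed

lemma
  assumes "monomial_ordering prec"
  shows monomial_ordering_irrefl: "\<not> prec \<alpha> \<alpha>"
    and monomial_ordering_trans: "prec \<alpha> \<beta> \<Longrightarrow> prec \<beta> \<gamma> \<Longrightarrow> prec \<alpha> \<gamma>"
    and monomial_ordering_total: "\<alpha> \<noteq> \<beta> \<Longrightarrow> prec \<alpha> \<beta> \<or> prec \<beta> \<alpha>"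
    and monomial_ordering_add: "prec \<alpha> \<beta> \<Longrightarrow> prec (\<alpha> + \<gamma>) (\<beta> + \<gamma>)"
    and monomial_ordering_wfp: "wfp prec"
proof -
  note ord = assms[unfolded monomial_ordering_def]
  show "\<not> prec \<alpha> \<alpha>"
    using ord by (simp add: irreflp_def)
  show "prec \<alpha> \<beta> \<Longrightarrow> prec \<beta> \<gamma> \<Longrightarrow> prec \<alpha> \<gamma>"
    using ord by (elim conjE) (rule transpD)
  show "\<alpha> \<noteq> \<beta> \<Longrightarrow> prec \<alpha> \<beta> \<or> prec \<beta> \<alpha>"
    using ord by (elim conjE) (erule totalpD)
  show "prec \<alpha> \<beta> \<Longrightarrow> prec (\<alpha> + \<gamma>) (\<beta> + \<gamma>)"
    using ord by simp
  show "wfp prec"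
    using ord by simp
qed

definition is_lead :: "('n expo \<Rightarrow> 'n expo \<Rightarrow> bool) \<Rightarrow> ('n, 'k::field) mpol \<Rightarrow> 'n expo \<Rightarrow> bool" where
  "is_lead prec p \<alpha> \<longleftrightarrow>
     \<alpha> \<in> Poly_Mapping.keys p \<and> (\<forall>\<beta>\<in>Poly_Mapping.keys p. \<beta> \<noteq> \<alpha> \<longrightarrow> prec \<beta> \<alpha>)"

lemma is_lead_exists:
  assumes "monomial_ordering prec" and "p \<noteq> 0"
  shows "\<exists>\<alpha>. is_lead prec p \<alpha>"
proof -
  have "\<exists>\<alpha>\<in>K. \<forall>\<beta>\<in>K. \<beta> \<noteq> \<alpha> \<longrightarrow> prec \<beta> \<alpha>" if "finite K" "K \<noteq> {}" for K
    using that
  proof (induction K rule: finite_ne_induct)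
    case (singleton x)
    show ?case by simp
  next
    case (insert x K)
    then obtain \<alpha> where \<alpha>: "\<alpha> \<in> K" "\<forall>\<beta>\<in>K. \<beta> \<noteq> \<alpha> \<longrightarrow> prec \<beta> \<alpha>" by blast
    have "prec x \<alpha> \<or> prec \<alpha> x"
      using monomial_ordering_total[OF assms(1)] insert.hyps \<alpha>(1) by metis
    then show ?case
    proof
      assume "prec x \<alpha>"
      with \<alpha> show ?thesis by auto
    next
      assume "prec \<alpha> x"
      with \<alpha> have "\<forall>\<beta>\<in>insert x K. \<beta> \<noteq> x \<longrightarrow> prec \<beta> x"
        using monomial_ordering_trans[OF assms(1), of _ \<alpha> x] by auto
      then show ?thesis by blast
    qed
  qed
  from this[of "Poly_Mapping.keys p"] assms(2) show ?thesis
    unfolding is_lead_def by auto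
qed

lemma is_lead_unique:
  assumes "monomial_ordering prec" "is_lead prec p \<alpha>" "is_lead prec p \<beta>"
  shows "\<alpha> = \<beta>"
  using assms(2,3) monomial_ordering_trans[OF assms(1)] monomial_ordering_irrefl[OF assms(1)]
  unfolding is_lead_def by metis

lemma lead_term_eq:
  assumes "monomial_ordering prec" "is_lead prec p \<alpha>"
  shows "lead_term prec p = Poly_Mapping.single \<alpha> (Poly_Mapping.lookup p \<alpha>)"
proof -
  have "{\<alpha>. is_lead prec p \<alpha>} = {\<alpha>}"
    using assms is_lead_unique by blast
  then show ?thesis
    by (simp add: lead_term_def flip: is_lead_def)
qed

lemma keys_single_mult:
  assumes "\<beta> \<in> Poly_Mapping.keys (Poly_Mapping.single \<gamma> c * q)"
  obtains \<delta> where "\<delta> \<in> Poly_Mapping.keys q" "\<beta> = \<gamma> + \<delta>"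
  using keys_mult[of "Poly_Mapping.single \<gamma> c" q] assms by (auto split: if_splits)

lemma lookup_single_mult:
  fixes q :: "('n, 'k::field) mpol"
  shows "Poly_Mapping.lookup (Poly_Mapping.single \<gamma> c * q) (\<gamma> + \<delta>) = c * Poly_Mapping.lookup q \<delta>"
proof (induction q rule: mpol_induct)
  case (single \<alpha> d)
  then show ?case by (simp add: mult_single lookup_single when_def)
qed (simp_all add: lookup_add algebra_simps)

text \<open>
  The cancellation step of division with remainder.
\<close>

lemma lead_cancel:
  fixes p q :: "('n, 'k::field) mpol"
  assumes ord: "monomial_ordering prec"
    and p: "is_lead prec p (\<gamma> + \<alpha>)" and q: "is_lead prec q \<alpha>"
    and \<beta>: "\<beta> \<in> Poly_Mapping.keys
      (p - Poly_Mapping.single \<gamma> (Poly_Mapping.lookup p (\<gamma> + \<alpha>) / Poly_Mapping.lookup q \<alpha>) * q)"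
  shows "prec \<beta> (\<gamma> + \<alpha>)"
proof -
  let ?c = "Poly_Mapping.lookup p (\<gamma> + \<alpha>) / Poly_Mapping.lookup q \<alpha>"
  have "Poly_Mapping.lookup q \<alpha> \<noteq> 0"
    using q by (simp add: is_lead_def in_keys_iff)
  then have ne: "\<beta> \<noteq> \<gamma> + \<alpha>"
    using \<beta> by (auto simp: in_keys_iff lookup_minus lookup_single_mult)
  have "\<beta> \<in> Poly_Mapping.keys p \<or> \<beta> \<in> Poly_Mapping.keys (Poly_Mapping.single \<gamma> ?c * q)"
    using \<beta> by (auto simp: in_keys_iff lookup_minus)
  then show ?thesis
  proof
    assume "\<beta> \<in> Poly_Mapping.keys p"
    with p ne show ?thesis by (simp add: is_lead_def)
  next
    assume "\<beta> \<in> Poly_Mapping.keys (Poly_Mapping.single \<gamma> ?c * q)"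
    then obtain \<delta> where \<delta>: "\<delta> \<in> Poly_Mapping.keys q" "\<beta> = \<gamma> + \<delta>"
      by (rule keys_single_mult)
    with ne q have "prec \<delta> \<alpha>" by (auto simp: is_lead_def)
    with ord have "prec (\<delta> + \<gamma>) (\<alpha> + \<gamma>)" by (simp add: monomial_ordering_def)
    with \<delta> show ?thesis by (simp add: add.commute)
  qed
qed

section \<open>Gradings of the polynomial ring by weights\<close>

text \<open>
  A weight \<open>w\<close> may take values in any type; equations between values are all that
  the decomposition into homogeneous components uses, so that simultaneous homogeneity for several
  weights can also be expressed by a weight with values in \<^typ>\<open>bool\<close>.
\<close>

definition homog_comp :: "('n expo \<Rightarrow> 'g) \<Rightarrow> 'g \<Rightarrow> ('n, 'k::field) mpol \<Rightarrow> ('n, 'k) mpol" where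
  "homog_comp w a p = Poly_Mapping.mapp (\<lambda>\<alpha> c. c when w \<alpha> = a) p"

definition weight_ge :: "('n expo \<Rightarrow> 'g::ord) \<Rightarrow> 'g \<Rightarrow> ('n, 'k::field) mpol set" where
  "weight_ge w a = {p. \<forall>\<alpha>\<in>Poly_Mapping.keys p. a \<le> w \<alpha>}"

definition weight_gt :: "('n expo \<Rightarrow> 'g::ord) \<Rightarrow> 'g \<Rightarrow> ('n, 'k::field) mpol set" where
  "weight_gt w a = {p. \<forall>\<alpha>\<in>Poly_Mapping.keys p. a < w \<alpha>}"

lemma lookup_homog_comp:
  "Poly_Mapping.lookup (homog_comp w a p) \<alpha> = (Poly_Mapping.lookup p \<alpha> when w \<alpha> = a)"
  by (simp add: homog_comp_def lookup_mapp when_def in_keys_iff)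

lemma keys_homog_comp: "Poly_Mapping.keys (homog_comp w a p) = {\<alpha>\<in>Poly_Mapping.keys p. w \<alpha> = a}"
  by (auto simp: in_keys_iff lookup_homog_comp)

lemma homog_comp_zero [simp]: "homog_comp w a 0 = 0"
  by (rule poly_mapping_eqI) (simp add: lookup_homog_comp)

lemma homog_comp_add: "homog_comp w a (p + q) = homog_comp w a p + homog_comp w a q"
  by (rule poly_mapping_eqI) (simp add: lookup_homog_comp lookup_add when_def)

lemma homog_comp_diff: "homog_comp w a (p - q) = homog_comp w a p - homog_comp w a q"
  by (rule poly_mapping_eqI) (simp add: lookup_homog_comp lookup_minus when_def)

lemma homog_comp_sum: "homog_comp w a (sum f S) = (\<Sum>s\<in>S. homog_comp w a (f s))"
  by (induction S rule: infinite_finite_induct) (simp_all add: homog_comp_add)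

lemma homog_comp_single: "homog_comp w a (Poly_Mapping.single \<alpha> c) = (Poly_Mapping.single \<alpha> c when w \<alpha> = a)"
  by (rule poly_mapping_eqI) (auto simp: lookup_homog_comp lookup_single when_def)

lemma homog_comp_homogeneous:
  "(\<And>\<alpha>. \<alpha> \<in> Poly_Mapping.keys p \<Longrightarrow> w \<alpha> = a) \<Longrightarrow> homog_comp w c p = (p when c = a)"
  by (rule poly_mapping_eqI) (auto simp: lookup_homog_comp when_def in_keys_iff)

lemma homog_comp_homog_comp: "homog_comp w c (homog_comp w a p) = (homog_comp w a p when c = a)"
  by (rule homog_comp_homogeneous) (simp add: keys_homog_comp)

lemma homog_comp_eq_0: "a \<notin> w ` Poly_Mapping.keys p \<Longrightarrow> homog_comp w a p = 0"
  by (rule poly_mapping_eqI) (auto simp: lookup_homog_comp when_def in_keys_iff)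

lemma homog_comp_weight_gt: "p \<in> weight_gt w (a::'g::preorder) \<Longrightarrow> homog_comp w a p = 0"
  by (rule homog_comp_eq_0) (auto simp: weight_gt_def)

lemma sum_homog_comp:
  assumes "finite T" "w ` Poly_Mapping.keys p \<subseteq> T"
  shows "(\<Sum>a\<in>T. homog_comp w a p) = p"
proof (rule poly_mapping_eqI)
  show "Poly_Mapping.lookup (\<Sum>a\<in>T. homog_comp w a p) \<alpha> = Poly_Mapping.lookup p \<alpha>" for \<alpha>
    using assms by (cases "\<alpha> \<in> Poly_Mapping.keys p")
      (auto simp: lookup_sum lookup_homog_comp when_def in_keys_iff)
qed

lemma homog_comp_in_weight_ge: "homog_comp w a p \<in> weight_ge w (a::'g::preorder)"
  by (auto simp: weight_ge_def keys_homog_comp)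

lemma single_in_weight_ge: "c = 0 \<or> a \<le> w \<alpha> \<Longrightarrow> Poly_Mapping.single \<alpha> c \<in> weight_ge w a"
  by (auto simp: weight_ge_def)

lemma weight_ge_zero [simp]: "0 \<in> weight_ge w a"
  and weight_gt_zero [simp]: "0 \<in> weight_gt w a"
  by (auto simp: weight_ge_def weight_gt_def)

lemma weight_ge_add: "p \<in> weight_ge w a \<Longrightarrow> q \<in> weight_ge w a \<Longrightarrow> p + q \<in> weight_ge w a"
  and weight_gt_add: "p \<in> weight_gt w a \<Longrightarrow> q \<in> weight_gt w a \<Longrightarrow> p + q \<in> weight_gt w a"
  using keys_add[of p q] by (auto simp: weight_ge_def weight_gt_def)

lemma keys_uminus_mpol: "Poly_Mapping.keys (- (p :: ('n, 'k::field) mpol)) = Poly_Mapping.keys p"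
  by (auto simp: in_keys_iff)

lemma weight_ge_diff: "p \<in> weight_ge w a \<Longrightarrow> q \<in> weight_ge w a \<Longrightarrow> p - q \<in> weight_ge w a"
  and weight_gt_diff: "p \<in> weight_gt w a \<Longrightarrow> q \<in> weight_gt w a \<Longrightarrow> p - q \<in> weight_gt w a"
  using weight_ge_add[of p w a "- q"] weight_gt_add[of p w a "- q"]
  by (auto simp: weight_ge_def weight_gt_def keys_uminus_mpol)

lemma weight_ge_sum: "(\<And>s. s \<in> S \<Longrightarrow> f s \<in> weight_ge w a) \<Longrightarrow> sum f S \<in> weight_ge w a"
  by (induction S rule: infinite_finite_induct) (auto intro: weight_ge_add)

lemma weight_gt_sum: "(\<And>s. s \<in> S \<Longrightarrow> f s \<in> weight_gt w a) \<Longrightarrow> sum f S \<in> weight_gt w a"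
  by (induction S rule: infinite_finite_induct) (auto intro: weight_gt_add)

lemma weight_ge_mono: "p \<in> weight_ge w a \<Longrightarrow> b \<le> a \<Longrightarrow> p \<in> weight_ge w (b::'g::preorder)"
  by (auto simp: weight_ge_def intro: order_trans)

lemma weight_ge_imp_gt: "p \<in> weight_ge w a \<Longrightarrow> b < a \<Longrightarrow> p \<in> weight_gt w (b::'g::preorder)"
  by (auto simp: weight_ge_def weight_gt_def intro: less_le_trans)

lemma weight_gt_imp_ge: "p \<in> weight_gt w a \<Longrightarrow> p \<in> weight_ge w (a::'g::preorder)"
  by (auto simp: weight_ge_def weight_gt_def intro: less_imp_le)

lemma weight_gt_minus_homog_comp:
  "p \<in> weight_ge w (a::'g::order) \<Longrightarrow> p - homog_comp w a p \<in> weight_gt w a"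
  by (auto simp: weight_ge_def weight_gt_def in_keys_iff lookup_minus lookup_homog_comp when_def
      order_le_less split: if_splits)

lemma pol_qval_in_weight_ge: "p \<in> weight_ge w (pol_qval w p)"
  by (auto simp: weight_ge_def pol_qval_def)

lemma weight_ge_iff_pol_qval: "p \<noteq> 0 \<Longrightarrow> p \<in> weight_ge w a \<longleftrightarrow> a \<le> pol_qval w p"
  by (simp add: weight_ge_def pol_qval_def)

lemma weight_gt_iff_pol_qval: "p \<noteq> 0 \<Longrightarrow> p \<in> weight_gt w a \<longleftrightarrow> a < pol_qval w p"
  by (simp add: weight_gt_def pol_qval_def)

lemma pol_qval_in_image: "p \<noteq> 0 \<Longrightarrow> pol_qval w p \<in> w ` Poly_Mapping.keys p"
  by (simp add: pol_qval_def)

lemma homog_comp_pol_qval_neq_0: "p \<noteq> 0 \<Longrightarrow> homog_comp w (pol_qval w p) p \<noteq> 0"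
  using pol_qval_in_image[of p w] by (auto simp: keys_homog_comp simp flip: keys_eq_empty)

lemma pol_qval_eqI:
  assumes "p \<in> weight_ge w a" "homog_comp w a p \<noteq> 0"
  shows "pol_qval w p = a"
proof -
  have "p \<noteq> 0"
    using assms(2) by auto
  moreover have "a \<in> w ` Poly_Mapping.keys p"
    using assms(2) homog_comp_eq_0 by metis
  ultimately show ?thesis
    using assms(1) unfolding pol_qval_def weight_ge_def
    by (intro Min_eqI) auto
qed

text \<open>
  Both the rank one weights \<open>weight u\<close> and the lexicographic weights
  \<open>mat_weight M\<close> are instances; all statements about filtrations, initial ideals and
  valuations are proved once for this common generality.
\<close>

locale additive_weight =
  fixes w :: "'n expo \<Rightarrow> 'g::linordered_ab_group_add"
  assumes w_add: "w (\<alpha> + \<beta>) = w \<alpha> + w \<beta>"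
begin

lemma w_zero: "w 0 = 0"
  using w_add[of 0 0] by simp

lemma weight_ge_mult: "p \<in> weight_ge w a \<Longrightarrow> q \<in> weight_ge w b \<Longrightarrow> p * q \<in> weight_ge w (a + b)"
  using keys_mult[of p q] by (fastforce simp: weight_ge_def w_add intro: add_mono)

lemma weight_gt_mult_ge: "p \<in> weight_gt w a \<Longrightarrow> q \<in> weight_ge w b \<Longrightarrow> p * q \<in> weight_gt w (a + b)"
  using keys_mult[of p q]
  by (fastforce simp: weight_ge_def weight_gt_def w_add intro: add_less_le_mono)

lemma weight_ge_mult_gt: "p \<in> weight_ge w a \<Longrightarrow> q \<in> weight_gt w b \<Longrightarrow> p * q \<in> weight_gt w (a + b)"
  using weight_gt_mult_ge[of q b p a] by (simp add: ac_simps)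

lemma homog_comp_mult_homogeneous:
  "homog_comp w c (homog_comp w a p * homog_comp w b q) =
    (homog_comp w a p * homog_comp w b q when c = a + b)"
proof (rule homog_comp_homogeneous)
  fix \<alpha> assume "\<alpha> \<in> Poly_Mapping.keys (homog_comp w a p * homog_comp w b q)"
  with keys_mult[of "homog_comp w a p" "homog_comp w b q"] show "w \<alpha> = a + b"
    by (auto simp: keys_homog_comp w_add)
qed

text \<open>
  Initial forms are multiplicative because the remaining terms of either factor only contribute
  terms of larger weight.
\<close>

lemma homog_comp_mult:
  assumes "p \<in> weight_ge w a" "q \<in> weight_ge w b"
  shows "homog_comp w (a + b) (p * q) = homog_comp w a p * homog_comp w b q"
proof -
  define r where "r = (p - homog_comp w a p) * q + homog_comp w a p * (q - homog_comp w b q)"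
  have "p * q = homog_comp w a p * homog_comp w b q + r"
    by (simp add: r_def algebra_simps)
  moreover have "r \<in> weight_gt w (a + b)"
    unfolding r_def using assms
    by (intro weight_gt_add weight_gt_mult_ge weight_ge_mult_gt weight_gt_minus_homog_comp
        homog_comp_in_weight_ge)
  ultimately show ?thesis
    by (simp add: homog_comp_add homog_comp_weight_gt homog_comp_mult_homogeneous)
qed

end

text \<open>
  The initial ideal of \<open>I\<close> described degree by degree: its part of weight
  \<open>a\<close> consists of the components of weight \<open>a\<close> of those elements of
  \<open>I\<close> whose terms all have weight at least \<open>a\<close>. Unlike a
  description by generators, this makes homogeneity of the ideal immediate, makes sense for
  weights of arbitrary rank, and is exactly what the associated graded ring sees.
\<close>

definition graded_init_ideal ::
  "('n expo \<Rightarrow> 'g::ord) \<Rightarrow> ('n, 'k::field) mpol set \<Rightarrow> ('n, 'k) mpol set" where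
  "graded_init_ideal w I =
     {p. \<forall>a. \<exists>g\<in>I. g \<in> weight_ge w a \<and> homog_comp w a g = homog_comp w a p}"

lemma homog_comp_graded_init_idealI:
  assumes I: "ideal I mpol_ring" and g: "g \<in> I" "g \<in> weight_ge w a"
  shows "homog_comp w a g \<in> graded_init_ideal w I"
  unfolding graded_init_ideal_def
proof (intro CollectI allI)
  fix c
  show "\<exists>h\<in>I. h \<in> weight_ge w c \<and> homog_comp w c h = homog_comp w c (homog_comp w a g)"
  proof (cases "c = a")
    case True
    with g show ?thesis by (auto simp: homog_comp_homog_comp)
  next
    case False
    with is_ideal_zero[OF I] show ?thesis
      by (intro bexI[of _ 0]) (auto simp: homog_comp_homog_comp)
  qed
qed

lemma graded_init_idealE:
  assumes "p \<in> graded_init_ideal w I"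
  obtains g where "g \<in> I" "g \<in> weight_ge w a" "homog_comp w a g = homog_comp w a p"
  using assms unfolding graded_init_ideal_def by blast

lemma homog_comp_graded_init_ideal:
  assumes "ideal I mpol_ring" and "p \<in> graded_init_ideal w I"
  shows "homog_comp w a p \<in> graded_init_ideal w I"
  using assms by (metis graded_init_idealE homog_comp_graded_init_idealI)

context additive_weight
begin

text \<open>
  The point is closure under multiplication: a product of homogeneous components
  \<open>r\<^sub>c p\<^sub>a\<close> is the component of weight \<open>c + a\<close> of
  \<open>r\<^sub>c g\<close>, where the relation \<open>g\<close> has initial part
  \<open>p\<^sub>a\<close>.
\<close>

lemma graded_init_ideal_ideal:
  assumes I: "ideal I mpol_ring"
  shows "ideal (graded_init_ideal w I) mpol_ring"
proof -
  have zero: "0 \<in> graded_init_ideal w I"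
    using is_ideal_zero[OF I] by (auto simp: graded_init_ideal_def intro!: bexI[of _ 0])
  have add: "p + q \<in> graded_init_ideal w I"
    if pq: "p \<in> graded_init_ideal w I" "q \<in> graded_init_ideal w I" for p q
    unfolding graded_init_ideal_def
  proof (intro CollectI allI)
    fix a
    obtain g h where "g \<in> I" "g \<in> weight_ge w a" "homog_comp w a g = homog_comp w a p"
      "h \<in> I" "h \<in> weight_ge w a" "homog_comp w a h = homog_comp w a q"
      using pq by (meson graded_init_idealE)
    then show "\<exists>g\<in>I. g \<in> weight_ge w a \<and> homog_comp w a g = homog_comp w a (p + q)"
      by (intro bexI[of _ "g + h"]) (auto simp: homog_comp_add intro: weight_ge_add is_ideal_add[OF I])
  qed
  have sum: "sum f S \<in> graded_init_ideal w I" if "\<And>s. s \<in> S \<Longrightarrow> f s \<in> graded_init_ideal w I"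
    for f and S :: "'g set"
    using that by (induction S rule: infinite_finite_induct) (auto intro: zero add)
  have mult: "r * p \<in> graded_init_ideal w I" if p: "p \<in> graded_init_ideal w I" for p r
  proof -
    have "homog_comp w c r * homog_comp w a p \<in> graded_init_ideal w I" for a c
    proof -
      obtain g where g: "g \<in> I" "g \<in> weight_ge w a" "homog_comp w a g = homog_comp w a p"
        using p by (rule graded_init_idealE)
      have "homog_comp w (c + a) (homog_comp w c r * g) \<in> graded_init_ideal w I"
        using g by (intro homog_comp_graded_init_idealI[OF I] is_ideal_mult[OF I] weight_ge_mult
            homog_comp_in_weight_ge)
      then show ?thesis
        using g by (simp add: homog_comp_mult homog_comp_in_weight_ge homog_comp_homog_comp)
    qed
    then have "(\<Sum>c\<in>w ` Poly_Mapping.keys r. \<Sum>a\<in>w ` Poly_Mapping.keys p.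
        homog_comp w c r * homog_comp w a p) \<in> graded_init_ideal w I"
      by (intro sum) auto
    also have "(\<Sum>c\<in>w ` Poly_Mapping.keys r. \<Sum>a\<in>w ` Poly_Mapping.keys p.
        homog_comp w c r * homog_comp w a p) = r * p"
      by (simp add: sum_homog_comp flip: sum_product)
    finally show ?thesis .
  qed
  show ?thesis
    unfolding ideal_ring_of_type_algebra_iff using zero add mult by blast
qed

end

section \<open>A graded form of Hilbert's basis theorem\<close>

text \<open>
  Polynomials of weight at least \<open>d\<close>, together with the degree \<open>d\<close>,
  are the elements of degree \<open>d\<close> of the polynomial ring with one further,
  homogenizing variable of degree \<open>-1\<close>. Under this reading \<open>comb_below w P m\<close>
  is the part of degree \<open>m\<close> of the ideal generated by \<open>P 0, \<dots>, P (m - 1)\<close>,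
  where \<open>P k\<close> is placed in degree \<open>k\<close>.
\<close>

definition comb_below :: "('n expo \<Rightarrow> int) \<Rightarrow> (nat \<Rightarrow> ('n, 'k::field) mpol) \<Rightarrow> nat \<Rightarrow> ('n, 'k) mpol set" where
  "comb_below w P m =
     {\<Sum>k<m. q k * P k | q. \<forall>k<m. q k \<in> weight_ge w (int m - int k)}"

lemma comb_below_add:
  assumes "x \<in> comb_below w P m" "y \<in> comb_below w P m"
  shows "x + y \<in> comb_below w P m"
proof -
  obtain q q' where "x = (\<Sum>k<m. q k * P k)" "\<forall>k<m. q k \<in> weight_ge w (int m - int k)"
    "y = (\<Sum>k<m. q' k * P k)" "\<forall>k<m. q' k \<in> weight_ge w (int m - int k)"
    using assms unfolding comb_below_def by blast
  then show ?thesis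
    unfolding comb_below_def
    by (intro CollectI exI[of _ "\<lambda>k. q k + q' k"]) (auto simp: sum.distrib algebra_simps intro: weight_ge_add)
qed

lemma zero_in_comb_below: "0 \<in> comb_below w P m"
  unfolding comb_below_def by (intro CollectI exI[of _ "\<lambda>_. 0"]) auto

lemma mult_in_comb_below:
  assumes "x \<in> weight_ge w (int m - int i)" "i < m"
  shows "x * P i \<in> comb_below w P m"
  unfolding comb_below_def
  by (rule CollectI, rule exI[of _ "\<lambda>k. if k = i then x else 0"])
    (use assms in \<open>auto simp: if_distrib[of "\<lambda>t. t * _"] cong: if_cong\<close>)

context
  fixes w :: "'n::finite expo \<Rightarrow> int"
  assumes aw: "additive_weight w"
begin

interpretation additive_weight w by (rule aw)

lemma comb_below_mult:
  assumes "y \<in> comb_below w P i" "x \<in> weight_ge w (int m - int i)" "i \<le> m"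
  shows "x * y \<in> comb_below w P m"
proof -
  obtain q where q: "y = (\<Sum>k<i. q k * P k)" "\<And>k. k < i \<Longrightarrow> q k \<in> weight_ge w (int i - int k)"
    using assms(1) unfolding comb_below_def by blast
  have "(x * q k) * P k \<in> comb_below w P m" if "k < i" for k
  proof (rule mult_in_comb_below)
    show "x * q k \<in> weight_ge w (int m - int k)"
      using weight_ge_mult[OF assms(2) q(2)[OF that]] by simp
  qed (use that assms(3) in simp)
  then have "(\<Sum>k<l. (x * q k) * P k) \<in> comb_below w P m" if "l \<le> i" for l
    using that
    by (induction l) (auto simp: zero_in_comb_below intro: comb_below_add)
  from this[of i] show ?thesis
    by (simp add: q(1) sum_distrib_left mult.assoc)
qed

text \<open>
  The homogeneous ideals generated by initial segments of \<open>P\<close> cannot grow forever.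
  If every \<open>P m\<close> were new, pick in each coset \<open>P m + comb_below w P m\<close>
  a representative \<open>r m\<close> with smallest leading exponent \<open>\<alpha> m\<close>. The
  exponent of the homogenizing variable in its leading term is \<open>w (\<alpha> m) - m\<close>, so
  Dickson's lemma, applied with this extra coordinate, provides \<open>i < j\<close> such that the
  leading term of \<open>r i\<close> divides that of \<open>r j\<close>. Subtracting the
  corresponding multiple of \<open>r i\<close> lowers the leading exponent within the coset of
  \<open>P j\<close>.
\<close>

lemma graded_hilbert_basis:
  fixes P :: "nat \<Rightarrow> ('n, 'k::field) mpol"
  assumes P: "\<And>m. P m \<in> weight_ge w (int m)"
  shows "\<exists>m. P m \<in> comb_below w P m"
proof (rule ccontr)
  assume "\<not> ?thesis"
  then have no: "P m \<notin> comb_below w P m" for m by blast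
  obtain prec :: "'n expo \<Rightarrow> 'n expo \<Rightarrow> bool" where ord: "monomial_ordering prec"
    using monomial_ordering_exists by blast
  define R where "R m = {r. P m - r \<in> comb_below w P m}" for m
  have R_nz: "r \<noteq> 0" if "r \<in> R m" for r m
    using that no[of m] by (auto simp: R_def)
  have comb_ge: "comb_below w P m \<subseteq> weight_ge w (int m)" for m
  proof
    fix x assume "x \<in> comb_below w P m"
    then obtain q where q: "x = (\<Sum>k<m. q k * P k)" "\<And>k. k < m \<Longrightarrow> q k \<in> weight_ge w (int m - int k)"
      unfolding comb_below_def by blast
    have "q k * P k \<in> weight_ge w (int m)" if "k < m" for k
      using weight_ge_mult[OF q(2)[OF that] P[of k]] by simp
    then show "x \<in> weight_ge w (int m)"
      unfolding q(1) by (intro weight_ge_sum) auto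
  qed
  have R_ge: "r \<in> weight_ge w (int m)" if "r \<in> R m" for r m
    using weight_ge_diff[OF P[of m], of "P m - r"] that comb_ge[of m] by (auto simp: R_def)
  have "\<exists>r \<alpha>. r \<in> R m \<and> is_lead prec r \<alpha> \<and> (\<forall>r'\<in>R m. \<forall>\<beta>. is_lead prec r' \<beta> \<longrightarrow> \<not> prec \<beta> \<alpha>)" for m
  proof -
    define Q where "Q = {\<alpha>. \<exists>r\<in>R m. is_lead prec r \<alpha>}"
    have "P m \<in> R m"
      by (simp add: R_def zero_in_comb_below)
    then have "Q \<noteq> {}"
      using is_lead_exists[OF ord R_nz] unfolding Q_def by blast
    with monomial_ordering_wfp[OF ord] obtain \<alpha> where "\<alpha> \<in> Q" "\<And>\<beta>. prec \<beta> \<alpha> \<Longrightarrow> \<beta> \<notin> Q"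
      unfolding wfp_eq_minimal by blast
    then show ?thesis
      unfolding Q_def by blast
  qed
  then obtain r \<alpha> where r: "\<And>m. r m \<in> R m" "\<And>m. is_lead prec (r m) (\<alpha> m)"
    and min: "\<And>m r' \<beta>. r' \<in> R m \<Longrightarrow> is_lead prec r' \<beta> \<Longrightarrow> \<not> prec \<beta> (\<alpha> m)"
    by metis
  have excess: "int m \<le> w (\<alpha> m)" for m
    using R_ge[OF r(1)[of m]] r(2)[of m] by (auto simp: weight_ge_def is_lead_def)
  obtain i j where ij: "i < j" "\<And>k. Poly_Mapping.lookup (\<alpha> i) k \<le> Poly_Mapping.lookup (\<alpha> j) k"
    "nat (w (\<alpha> i) - int i) \<le> nat (w (\<alpha> j) - int j)"
    using dickson_good_pair[of \<alpha> "\<lambda>m. nat (w (\<alpha> m) - int m)"] by metis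
  define \<gamma> where "\<gamma> = \<alpha> j - \<alpha> i"
  have \<gamma>: "\<alpha> j = \<gamma> + \<alpha> i"
    unfolding \<gamma>_def using ij(2) by (intro poly_mapping_eqI) (simp add: lookup_add lookup_minus)
  have w\<gamma>: "int j - int i \<le> w \<gamma>"
    using ij(3) excess[of i] excess[of j] by (simp add: \<gamma> w_add)
  define c where "c = Poly_Mapping.lookup (r j) (\<alpha> j) / Poly_Mapping.lookup (r i) (\<alpha> i)"
  define t where "t = Poly_Mapping.single \<gamma> c"
  have t: "t \<in> weight_ge w (int j - int i)"
    unfolding t_def using w\<gamma> by (intro single_in_weight_ge) simp
  have "t * P i - t * (P i - r i) \<in> comb_below w P j"
  proof -
    have "(- t) * (P i - r i) \<in> comb_below w P j"
      using t r(1)[of i] ij(1) weight_ge_diff[OF weight_ge_zero t]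
      by (intro comb_below_mult[where i = i]) (auto simp: R_def)
    moreover have "t * P i \<in> comb_below w P j"
      using t ij(1) by (rule mult_in_comb_below)
    ultimately show ?thesis
      using comb_below_add by fastforce
  qed
  then have "t * r i \<in> comb_below w P j"
    by (simp add: algebra_simps)
  then have "(P j - r j) + t * r i \<in> comb_below w P j"
    using r(1)[of j] by (auto simp: R_def intro: comb_below_add)
  then have s: "r j - t * r i \<in> R j"
    by (simp add: R_def algebra_simps)
  then obtain \<beta> where \<beta>: "is_lead prec (r j - t * r i) \<beta>"
    using is_lead_exists[OF ord R_nz] by blast
  have "prec \<beta> (\<alpha> j)"
    using lead_cancel[OF ord, of "r j" \<gamma> "\<alpha> i" "r i" \<beta>] r(2)[of i] r(2)[of j] \<beta>
    unfolding t_def c_def \<gamma>[symmetric] by (simp add: is_lead_def)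
  with min[OF s \<beta>] show False by simp
qed

end

section \<open>The presentation of the algebra\<close>

lemma eval_hom_superset:
  assumes "k_algebra smul" "finite K" "Poly_Mapping.keys p \<subseteq> K"
  shows "eval_hom smul b p =
    (\<Sum>\<alpha>\<in>K. smul (Poly_Mapping.lookup p \<alpha>) (\<Prod>j\<in>UNIV. b j ^ Poly_Mapping.lookup \<alpha> j))"
proof -
  interpret k_algebra smul by fact
  show ?thesis
    unfolding eval_hom_def using assms(2,3)
    by (intro sum.mono_neutral_left) (auto simp: in_keys_iff)
qed

locale presented_algebra = k_algebra smul
  for smul :: "'k::field \<Rightarrow> 'a::idom \<Rightarrow> 'a" +
  fixes b :: "'n::finite \<Rightarrow> 'a"
  assumes generators: "algebra_generators smul (range b)"
begin

abbreviation \<pi> :: "('n, 'k) mpol \<Rightarrow> 'a" where "\<pi> \<equiv> eval_hom smul b"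
abbreviation I :: "('n, 'k) mpol set" where "I \<equiv> kernel_ideal smul b"

lemma k_algebra: "k_algebra smul" ..

lemma smul_mult_smul: "smul c x * smul d y = smul (c * d) (x * y)"
  by (metis mult.commute scale_scale smul_mult_left)

lemma \<pi>_zero [simp]: "\<pi> 0 = 0"
  by (simp add: eval_hom_def)

lemma \<pi>_single: "\<pi> (Poly_Mapping.single \<alpha> c) = smul c (\<Prod>j\<in>UNIV. b j ^ Poly_Mapping.lookup \<alpha> j)"
  by (simp add: eval_hom_def)

lemma \<pi>_one [simp]: "\<pi> 1 = 1"
  using \<pi>_single[of 0 1] by simp

lemma \<pi>_add: "\<pi> (p + q) = \<pi> p + \<pi> q"
proof -
  let ?K = "Poly_Mapping.keys p \<union> Poly_Mapping.keys q"
  have K: "finite ?K" "Poly_Mapping.keys (p + q) \<subseteq> ?K" "Poly_Mapping.keys p \<subseteq> ?K" "Poly_Mapping.keys q \<subseteq> ?K"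
    using keys_add[of p q] by auto
  show ?thesis
    using K by (simp add: eval_hom_superset[OF k_algebra, of ?K] lookup_add scale_left_distrib sum.distrib)
qed

lemma \<pi>_mult: "\<pi> (p * q) = \<pi> p * \<pi> q"
proof (induction p rule: mpol_induct)
  case (single \<alpha> c)
  show ?case
    by (induction q rule: mpol_induct)
      (simp_all add: \<pi>_add distrib_left mult_single \<pi>_single smul_mult_smul lookup_add power_add prod.distrib)
qed (simp_all add: \<pi>_add distrib_right)

lemma \<pi>_uminus: "\<pi> (- p) = - \<pi> p"
  using \<pi>_add[of p "- p"] by (simp add: eq_neg_iff_add_eq_0 add.commute)

lemma \<pi>_diff: "\<pi> (p - q) = \<pi> p - \<pi> q"
  using \<pi>_add[of p "- q"] by (simp add: \<pi>_uminus)

lemma \<pi>_sum: "\<pi> (sum f S) = (\<Sum>s\<in>S. \<pi> (f s))"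
  by (induction S rule: infinite_finite_induct) (simp_all add: \<pi>_add)

lemma \<pi>_const: "\<pi> (const_pol c * p) = smul c (\<pi> p)"
  by (simp add: \<pi>_mult \<pi>_single smul_mult_left)

lemma \<pi>_var: "\<pi> (monomial (Poly_Mapping.single j 1)) = b j"
proof -
  have "b i ^ Poly_Mapping.lookup (Poly_Mapping.single j 1) i = (if i = j then b j else 1)" for i
    by (simp add: lookup_single when_def)
  then show ?thesis by (simp add: \<pi>_single)
qed

lemma \<pi>_expand: "\<pi> p = (\<Sum>\<alpha>\<in>Poly_Mapping.keys p. smul (Poly_Mapping.lookup p \<alpha>) (\<pi> (monomial \<alpha>)))"
  by (simp add: eval_hom_def)

lemma \<pi>_surj: "\<exists>p. \<pi> p = f"
proof -
  have "\<pi> p + \<pi> q \<in> range \<pi>" "\<pi> p * \<pi> q \<in> range \<pi>" "smul c (\<pi> p) \<in> range \<pi>" "1 \<in> range \<pi>" for p q c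
    by (metis \<pi>_add rangeI, metis \<pi>_mult rangeI, metis \<pi>_const rangeI, metis \<pi>_one rangeI)
  then have "is_subalgebra smul (range \<pi>)"
    unfolding is_subalgebra_def by blast
  moreover have "range b \<subseteq> range \<pi>"
    using \<pi>_var by (metis image_subsetI rangeI)
  ultimately have "is_subalgebra smul hull range b \<subseteq> range \<pi>"
    by (intro hull_minimal)
  then show ?thesis
    using generators unfolding algebra_generators_def by (metis UNIV_I rangeE subsetD)
qed

lemma in_I_iff: "p \<in> I \<longleftrightarrow> \<pi> p = 0"
  by (simp add: kernel_ideal_def)

lemma I_ideal: "ideal I mpol_ring"
  unfolding ideal_ring_of_type_algebra_iff by (auto simp: in_I_iff \<pi>_add \<pi>_mult)

end

section \<open>Initial ideals of rational weights\<close>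

context presented_algebra
begin

text \<open>
  Krull's intersection theorem for the Rees algebra of the weight filtration, in terms of elements.
  If \<open>f\<close> has representatives \<open>P k\<close> of weight at least \<open>k\<close>
  for all \<open>k\<close>, then for some \<open>m\<close> the polynomial \<open>P m\<close> is a
  combination of the earlier ones with coefficients \<open>q k\<close> of weight at least
  \<open>m - k > 0\<close>. All \<open>P k\<close> map to \<open>f\<close>, hence
  \<open>f = \<pi> (\<Sum>q k) f\<close>, and \<open>f\<close> cancels in the domain.
\<close>

lemma no_infinite_value:
  fixes w :: "'n expo \<Rightarrow> int"
  assumes aw: "additive_weight w" and "f \<noteq> 0"
    and rep: "\<And>k::nat. \<exists>p. \<pi> p = f \<and> p \<in> weight_ge w (int k)"
  shows "\<exists>q. \<pi> q = 1 \<and> q \<in> weight_gt w 0"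
proof -
  obtain P where P: "\<And>k. \<pi> (P k) = f" "\<And>k. P k \<in> weight_ge w (int k)"
    using rep by metis
  obtain m where "P m \<in> comb_below w P m"
    using graded_hilbert_basis[OF aw, of P] P(2) by blast
  then obtain q where q: "P m = (\<Sum>k<m. q k * P k)" "\<And>k. k < m \<Longrightarrow> q k \<in> weight_ge w (int m - int k)"
    unfolding comb_below_def by blast
  have "\<pi> (P m) = \<pi> (\<Sum>k<m. q k) * f"
    unfolding q(1) by (simp add: \<pi>_sum \<pi>_mult P(1) sum_distrib_right)
  then have "\<pi> (\<Sum>k<m. q k) = 1"
    using P(1) \<open>f \<noteq> 0\<close> by simp
  moreover have "(\<Sum>k<m. q k) \<in> weight_gt w 0"
    by (intro weight_gt_sum weight_ge_imp_gt[OF q(2)]) auto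
  ultimately show ?thesis by blast
qed

end

lemma weight_alt: "weight u \<alpha> = (\<Sum>j\<in>UNIV. u $ j * of_nat (Poly_Mapping.lookup \<alpha> j))"
  by (simp add: weight_def expo_vec_def)

lemma additive_weight_weight: "additive_weight (weight u)"
  by standard (simp add: weight_alt lookup_add distrib_left sum.distrib)

lemma weight_clear_denominators:
  fixes u :: "rat ^ 'n::finite"
  obtains d :: rat and w :: "'n expo \<Rightarrow> int"
  where "d > 0" "additive_weight w" "\<And>\<alpha>. of_int (w \<alpha>) = d * weight u \<alpha>"
proof -
  define den where "den j = snd (quotient_of (u $ j))" for j
  have den: "den j > 0" for j
    by (simp add: den_def quotient_of_denom_pos')
  define d :: rat where "d = of_int (prod den UNIV)"
  have "\<exists>z. of_int z = d * u $ j" for j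
  proof
    have "prod den UNIV = den j * prod den (UNIV - {j})"
      by (rule prod.remove) auto
    moreover have "u $ j = of_int (fst (quotient_of (u $ j))) / of_int (den j)"
      unfolding den_def by (rule quotient_of_div) simp
    ultimately show "of_int (prod den (UNIV - {j}) * fst (quotient_of (u $ j))) = d * u $ j"
      using den[of j] unfolding d_def by (simp add: field_simps)
  qed
  then obtain z where z: "\<And>j. of_int (z j) = d * u $ j"
    by metis
  show ?thesis
  proof (rule that)
    show "d > 0"
      unfolding d_def using den by (simp add: prod_pos)
    show "additive_weight (\<lambda>\<alpha>. \<Sum>j\<in>UNIV. z j * int (Poly_Mapping.lookup \<alpha> j))"
      by standard (simp add: lookup_add distrib_left sum.distrib)
    show "of_int (\<Sum>j\<in>UNIV. z j * int (Poly_Mapping.lookup \<alpha> j)) = d * weight u \<alpha>" for \<alpha>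
      by (simp add: z weight_alt sum_distrib_left mult.assoc)
  qed
qed

lemma init_form_eq:
  assumes "p \<noteq> 0"
  shows "init_form u p = homog_comp (weight u) (pol_qval (weight u) p) p"
proof -
  have "{\<alpha>. \<alpha> \<in> Poly_Mapping.keys p \<and> (\<forall>\<beta>\<in>Poly_Mapping.keys p. weight u \<alpha> \<le> weight u \<beta>)}
      = Poly_Mapping.keys (homog_comp (weight u) (pol_qval (weight u) p) p)" (is "?A = ?B")
  proof
    show "?A \<subseteq> ?B"
      by (auto simp: keys_homog_comp pol_qval_def intro!: Min_eqI[symmetric])
    show "?B \<subseteq> ?A"
      using pol_qval_in_weight_ge[of p "weight u"] by (auto simp: keys_homog_comp weight_ge_def)
  qed
  then show ?thesis
    unfolding init_form_def
    by (subst mpol_expand) (auto simp: keys_homog_comp lookup_homog_comp intro!: sum.cong)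
qed

lemma init_form_zero [simp]: "init_form u 0 = 0"
  by (simp add: init_form_def)

text \<open>
  Each nonzero component of an element of the graded initial ideal is itself the initial form of
  an element of \<open>I\<close>, so both descriptions have the same generators.
\<close>

lemma init_ideal_eq_graded_init_ideal:
  assumes I: "ideal I mpol_ring"
  shows "init_ideal u I = graded_init_ideal (weight u) I"
proof
  interpret additive_weight "weight u" by (rule additive_weight_weight)
  have "init_form u p \<in> graded_init_ideal (weight u) I" if "p \<in> I" for p
    using that is_ideal_zero[OF graded_init_ideal_ideal[OF I]]
      homog_comp_graded_init_idealI[OF I that pol_qval_in_weight_ge, of "weight u"]
    by (cases "p = 0") (auto simp: init_form_eq)
  then show "init_ideal u I \<subseteq> graded_init_ideal (weight u) I"
    unfolding init_ideal_def
    by (intro genideal_ring_of_type_algebra(3) graded_init_ideal_ideal I) auto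
  show "graded_init_ideal (weight u) I \<subseteq> init_ideal u I"
  proof
    fix p assume p: "p \<in> graded_init_ideal (weight u) I"
    have id: "ideal (init_ideal u I) mpol_ring"
      unfolding init_ideal_def by (rule genideal_ring_of_type_algebra(1))
    have "homog_comp (weight u) a p \<in> init_ideal u I" for a
    proof -
      obtain g where g: "g \<in> I" "g \<in> weight_ge (weight u) a"
        "homog_comp (weight u) a g = homog_comp (weight u) a p"
        using p by (rule graded_init_idealE)
      show ?thesis
      proof (cases "homog_comp (weight u) a g = 0")
        case True
        with g(3) is_ideal_zero[OF id] show ?thesis by simp
      next
        case False
        with g have "homog_comp (weight u) a p = init_form u g"
          by (subst init_form_eq) (auto simp: pol_qval_eqI)
        then show ?thesis
          using g(1) genideal_ring_of_type_algebra(2)[of "init_form u ` I"]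
          unfolding init_ideal_def by auto
      qed
    qed
    then have "(\<Sum>a\<in>weight u ` Poly_Mapping.keys p. homog_comp (weight u) a p) \<in> init_ideal u I"
      by (intro is_ideal_sum[OF id])
    then show "p \<in> init_ideal u I"
      by (simp add: sum_homog_comp)
  qed
qed

context presented_algebra
begin

text \<open>
  Call a representative of \<open>f\<close> detecting if its initial form lies outside the initial
  ideal. A representative that is not detecting can be improved: subtract a relation with the same
  initial form. Since the weights have bounded denominators, endless improvement makes the weight
  unbounded, so \<open>1\<close> has a representative \<open>q\<close> of positive
  weight. Then \<open>1 - q\<close> is a relation with initial form \<open>1\<close>, and the
  initial ideal is the unit ideal. Weights of mixed signs are what makes an argument necessary: the
  weights of the representatives of \<open>f\<close> have no evident upper bound.
\<close>

lemma detecting_representative_weight: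
  assumes proper: "1 \<notin> graded_init_ideal (weight u) I" and "f \<noteq> 0"
  shows "\<exists>p. \<pi> p = f \<and> homog_comp (weight u) (pol_qval (weight u) p) p \<notin> graded_init_ideal (weight u) I"
proof (rule ccontr)
  assume "\<not> ?thesis"
  then have bad: "homog_comp (weight u) (pol_qval (weight u) p) p \<in> graded_init_ideal (weight u) I"
    if "\<pi> p = f" for p using that by blast
  obtain d w where d: "d > 0" and aw: "additive_weight w" and w: "\<And>\<alpha>. of_int (w \<alpha>) = d * weight u \<alpha>"
    using weight_clear_denominators[of u] by metis
  have w_less: "w \<alpha> < w \<beta> \<longleftrightarrow> weight u \<alpha> < weight u \<beta>" for \<alpha> \<beta>
    using d w[of \<alpha>] w[of \<beta>] by (metis mult_less_cancel_left_pos of_int_less_iff)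
  have w_pos: "0 < w \<alpha> \<longleftrightarrow> 0 < weight u \<alpha>" for \<alpha>
    using d w[of \<alpha>] by (metis of_int_0_less_iff zero_less_mult_pos mult_pos_pos)
  obtain p0 where p0: "\<pi> p0 = f"
    using \<pi>_surj by blast
  have improve: "\<exists>p. \<pi> p = f \<and> p \<in> weight_ge w (pol_qval w p0 + int k)" for k
  proof (induction k)
    case 0
    show ?case
      using p0 pol_qval_in_weight_ge[of p0 w] by auto
  next
    case (Suc k)
    then obtain p where p: "\<pi> p = f" "p \<in> weight_ge w (pol_qval w p0 + int k)" by blast
    let ?v = "pol_qval (weight u) p"
    \<comment> \<open>Subtracting \<open>g\<close> removes all terms of \<open>p\<close> of the lowest weight; the
      integral weight \<open>w\<close> then grows by at least one.\<close>
    obtain g where g: "g \<in> I" "g \<in> weight_ge (weight u) ?v"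
      "homog_comp (weight u) ?v g = homog_comp (weight u) ?v (homog_comp (weight u) ?v p)"
      using bad[OF p(1)] by (rule graded_init_idealE)
    have "p \<noteq> 0"
      using p(1) \<open>f \<noteq> 0\<close> by auto
    then obtain \<alpha> where \<alpha>: "\<alpha> \<in> Poly_Mapping.keys p" "weight u \<alpha> = ?v"
      using pol_qval_in_image[of p "weight u"] by (metis imageE)
    have "p - g \<in> weight_gt (weight u) ?v"
      using weight_gt_minus_homog_comp[OF weight_ge_diff[OF pol_qval_in_weight_ge g(2)]] g(3)
      by (simp add: homog_comp_diff homog_comp_homog_comp)
    then have "w \<alpha> < w \<beta>" if "\<beta> \<in> Poly_Mapping.keys (p - g)" for \<beta>
      using that \<alpha>(2) by (simp add: w_less weight_gt_def)
    moreover have "pol_qval w p0 + int k \<le> w \<alpha>"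
      using p(2) \<alpha>(1) by (simp add: weight_ge_def)
    ultimately have "p - g \<in> weight_ge w (pol_qval w p0 + int (Suc k))"
      by (force simp: weight_ge_def)
    moreover have "\<pi> (p - g) = f"
      using p(1) g(1) by (simp add: \<pi>_diff in_I_iff)
    ultimately show ?case by blast
  qed
  have "\<exists>p. \<pi> p = f \<and> p \<in> weight_ge w (int k)" for k
    using improve[of "k + nat (- pol_qval w p0)"] by (force intro: weight_ge_mono)
  then obtain q where q: "\<pi> q = 1" "q \<in> weight_gt w 0"
    using no_infinite_value[OF aw \<open>f \<noteq> 0\<close>] by blast
  then have q0: "q \<in> weight_gt (weight u) 0"
    by (simp add: weight_gt_def w_pos)
  interpret u: additive_weight "weight u" by (rule additive_weight_weight)
  have one: "homog_comp (weight u) 0 (1 :: ('n, 'k) mpol) = 1" "(1 :: ('n, 'k) mpol) \<in> weight_ge (weight u) 0"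
    using homog_comp_single[of "weight u" 0 0 1] single_in_weight_ge[of 1 0 "weight u" 0]
    by (simp_all add: u.w_zero)
  have "1 - q \<in> I"
    using q(1) by (simp add: in_I_iff \<pi>_diff)
  then have "homog_comp (weight u) 0 (1 - q) \<in> graded_init_ideal (weight u) I"
    by (intro homog_comp_graded_init_idealI I_ideal weight_ge_diff one weight_gt_imp_ge q0)
  then show False
    using proper one(1) homog_comp_weight_gt[OF q0] by (simp add: homog_comp_diff)
qed

end

section \<open>Lexicographic weights\<close>

lemma lookup_mat_weight: "Poly_Mapping.lookup (mat_weight M \<alpha>) i = weight (M $ i) \<alpha>"
  by (simp add: mat_weight_def lex_vec_def matrix_vector_mult_def weight_def lookup_Abs_poly_mapping)

lemma additive_weight_mat_weight: "additive_weight (mat_weight M)"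
  by standard
    (intro poly_mapping_eqI, simp add: lookup_add lookup_mat_weight additive_weight.w_add[OF additive_weight_weight])

text \<open>
  The smallest row index carries the most significant coordinate; everything that is needed about
  the lexicographic order is how it relates to this first coordinate.
\<close>

lemma less_lexI:
  fixes x y :: "'r::{finite,linorder} \<Rightarrow>\<^sub>0 rat"
  assumes "Poly_Mapping.lookup x (Min UNIV) < Poly_Mapping.lookup y (Min UNIV)"
  shows "x < y"
  unfolding less_poly_mapping.rep_eq less_fun_def
  using assms by (intro exI[of _ "Min UNIV"]) (auto simp: not_less[symmetric])

lemma le_lexD:
  fixes x y :: "'r::{finite,linorder} \<Rightarrow>\<^sub>0 rat"
  assumes "x \<le> y"
  shows "Poly_Mapping.lookup x (Min UNIV) \<le> Poly_Mapping.lookup y (Min UNIV)"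
  using less_lexI[of y x] assms by (meson leD not_le)

text \<open>
  An ideal that is homogeneous for each row of \<open>M\<close> is homogeneous for
  \<open>M\<close>: the component of \<open>M\<close>-weight \<open>a\<close> is cut out by
  taking the components for the rows one after the other.
\<close>

lemma homog_comp_mat_weight_mem:
  fixes M :: "rat ^ 'n::finite ^ 'r::{finite,linorder}" and J :: "('n, 'k::field) mpol set"
  assumes J: "\<And>i a p. p \<in> J \<Longrightarrow> homog_comp (weight (M $ i)) a p \<in> J" and "p \<in> J"
  shows "homog_comp (mat_weight M) a p \<in> J"
proof -
  define h where "h S = homog_comp (\<lambda>\<alpha>. \<forall>i\<in>S. weight (M $ i) \<alpha> = Poly_Mapping.lookup a i) True p" for S
  have "h S \<in> J" if "finite S" for S
    using that
  proof (induction S)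
    case empty
    have "h {} = p"
      by (rule poly_mapping_eqI) (simp add: h_def lookup_homog_comp)
    with \<open>p \<in> J\<close> show ?case by simp
  next
    case (insert i S)
    have "h (insert i S) = homog_comp (weight (M $ i)) (Poly_Mapping.lookup a i) (h S)"
      by (rule poly_mapping_eqI) (simp add: h_def lookup_homog_comp when_when conj_commute)
    with J[OF insert.IH] show ?case by simp
  qed
  moreover have "h UNIV = homog_comp (mat_weight M) a p"
    by (rule poly_mapping_eqI)
      (simp add: h_def lookup_homog_comp poly_mapping_eq_iff fun_eq_iff lookup_mat_weight)
  ultimately show ?thesis
    by (metis finite_class.finite_UNIV)
qed

text \<open>
  An initial form for \<open>M\<close> is a homogeneous component of the initial form for the first
  row, and \<open>J\<close> is homogeneous for all rows; this gives one inclusion. Conversely an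
  \<open>M\<close>-homogeneous element of \<open>J\<close> is the initial form for the first row
  of some relation \<open>g\<close>. The remaining terms of \<open>g\<close> have a larger first
  coordinate, so they are lexicographically larger, and the same element is the initial form of
  \<open>g\<close> for \<open>M\<close>.
\<close>

lemma graded_init_ideal_mat_weight:
  fixes M :: "rat ^ 'n::finite ^ 'r::{finite,linorder}" and I :: "('n, 'k::field) mpol set"
  assumes I: "ideal I mpol_ring" and J: "\<And>i. graded_init_ideal (weight (M $ i)) I = J"
  shows "graded_init_ideal (mat_weight M) I = J"
proof -
  let ?w = "mat_weight M" and ?u = "weight (M $ Min UNIV)"
  interpret M: additive_weight ?w by (rule additive_weight_mat_weight)
  have u: "Poly_Mapping.lookup (?w \<alpha>) (Min UNIV) = ?u \<alpha>" for \<alpha>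
    by (rule lookup_mat_weight)
  have hom: "homog_comp ?w a p \<in> J" if "p \<in> J" for a p
    using that homog_comp_graded_init_ideal[OF I] J by (intro homog_comp_mat_weight_mem) blast+
  have J_ideal: "ideal J mpol_ring"
    using additive_weight.graded_init_ideal_ideal[OF additive_weight_weight I] J by metis
  show ?thesis
  proof
    show "graded_init_ideal ?w I \<subseteq> J"
    proof
      fix p assume p: "p \<in> graded_init_ideal ?w I"
      have "homog_comp ?w a p \<in> J" for a
      proof -
        obtain g where g: "g \<in> I" "g \<in> weight_ge ?w a" "homog_comp ?w a g = homog_comp ?w a p"
          using p by (rule graded_init_idealE)
        let ?a = "Poly_Mapping.lookup a (Min UNIV)"
        have "g \<in> weight_ge ?u ?a"
          using g(2) le_lexD u by (fastforce simp: weight_ge_def)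
        then have "homog_comp ?u ?a g \<in> J"
          using g(1) homog_comp_graded_init_idealI[OF I] J by blast
        then have "homog_comp ?w a (homog_comp ?u ?a g) \<in> J"
          by (rule hom)
        also have "homog_comp ?w a (homog_comp ?u ?a g) = homog_comp ?w a g"
          by (rule poly_mapping_eqI) (auto simp: lookup_homog_comp when_def u[symmetric])
        finally show ?thesis
          using g(3) by simp
      qed
      then have "(\<Sum>a\<in>?w ` Poly_Mapping.keys p. homog_comp ?w a p) \<in> J"
        by (intro is_ideal_sum[OF J_ideal])
      then show "p \<in> J"
        by (simp add: sum_homog_comp)
    qed
    show "J \<subseteq> graded_init_ideal ?w I"
    proof
      fix p assume p: "p \<in> J"
      have "homog_comp ?w a p \<in> graded_init_ideal ?w I" for a
      proof -
        let ?a = "Poly_Mapping.lookup a (Min UNIV)" and ?q = "homog_comp ?w a p"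
        have "?q \<in> graded_init_ideal ?u I"
          using hom[OF p] J by blast
        then obtain g where g: "g \<in> I" "g \<in> weight_ge ?u ?a" "homog_comp ?u ?a g = homog_comp ?u ?a ?q"
          by (rule graded_init_idealE)
        have q: "homog_comp ?u ?a ?q = ?q"
          by (rule poly_mapping_eqI) (auto simp: lookup_homog_comp when_def u[symmetric])
        have keys: "?w \<alpha> = a \<or> a < ?w \<alpha>" if "\<alpha> \<in> Poly_Mapping.keys g" for \<alpha>
        proof (cases "?u \<alpha> = ?a")
          case True
          then have "\<alpha> \<in> Poly_Mapping.keys ?q"
            using that g(3) q by (metis (mono_tags, lifting) keys_homog_comp mem_Collect_eq)
          then show ?thesis by (simp add: keys_homog_comp)
        next
          case False
          with g(2) that have "?a < ?u \<alpha>" by (auto simp: weight_ge_def)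
          then show ?thesis using less_lexI u by metis
        qed
        then have "g \<in> weight_ge ?w a"
          by (auto simp: weight_ge_def order_le_less)
        then have "homog_comp ?w a g \<in> graded_init_ideal ?w I"
          using g(1) by (intro homog_comp_graded_init_idealI[OF I])
        also have "homog_comp ?w a g = homog_comp ?w a (homog_comp ?u ?a g)"
          by (rule poly_mapping_eqI) (auto simp: lookup_homog_comp when_def u[symmetric])
        also have "\<dots> = ?q"
          unfolding g(3) q by (simp add: homog_comp_homog_comp)
        finally show ?thesis .
      qed
      then have "(\<Sum>a\<in>?w ` Poly_Mapping.keys p. homog_comp ?w a p) \<in> graded_init_ideal ?w I"
        by (intro is_ideal_sum[OF M.graded_init_ideal_ideal[OF I]])
      then show "p \<in> graded_init_ideal ?w I"
        by (simp add: sum_homog_comp)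
    qed
  qed
qed

text \<open>
  Begin with a representative that detects \<open>f\<close> for the first row, split its initial
  form \<open>q\<close> for that row into \<open>M\<close>-homogeneous components, and let
  \<open>h\<close> be the sum of the components in \<open>J\<close>. Subtracting a relation whose
  initial form for the first row is \<open>h\<close> leaves only the components outside
  \<open>J\<close>, of which there is at least one since \<open>q \<notin> J\<close>; the lowest
  of them is the initial form for \<open>M\<close>.
\<close>

lemma (in presented_algebra) detecting_representative_mat_weight:
  fixes M :: "rat ^ 'n ^ 'r::{finite,linorder}"
  assumes J: "\<And>i. graded_init_ideal (weight (M $ i)) I = J" and proper: "1 \<notin> J" and "f \<noteq> 0"
  shows "\<exists>p. \<pi> p = f \<and> homog_comp (mat_weight M) (pol_qval (mat_weight M) p) p \<notin> J"
proof -
  let ?w = "mat_weight M" and ?u = "weight (M $ Min UNIV)"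
  have u: "Poly_Mapping.lookup (?w \<alpha>) (Min UNIV) = ?u \<alpha>" for \<alpha>
    by (rule lookup_mat_weight)
  have J_ideal: "ideal J mpol_ring"
    using additive_weight.graded_init_ideal_ideal[OF additive_weight_weight I_ideal] J by metis
  obtain p where p: "\<pi> p = f" "homog_comp ?u (pol_qval ?u p) p \<notin> J"
    using detecting_representative_weight[of "M $ Min UNIV" f] J proper \<open>f \<noteq> 0\<close> by auto
  define a where "a = pol_qval ?u p"
  define q where "q = homog_comp ?u a p"
  define T where "T = ?w ` Poly_Mapping.keys q"
  define h where "h = (\<Sum>c\<in>{c\<in>T. homog_comp ?w c q \<in> J}. homog_comp ?w c q)"
  define h' where "h' = (\<Sum>c\<in>{c\<in>T. homog_comp ?w c q \<notin> J}. homog_comp ?w c q)"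
  have "finite T" by (simp add: T_def)
  have q_split: "q = h + h'"
  proof -
    have "q = (\<Sum>c\<in>T. homog_comp ?w c q)"
      by (simp add: sum_homog_comp T_def)
    also have "\<dots> = h + h'"
      unfolding h_def h'_def using \<open>finite T\<close>
      by (subst sum.union_disjoint[symmetric]) (auto intro!: sum.cong)
    finally show ?thesis .
  qed
  have "h \<in> J"
    unfolding h_def by (intro is_ideal_sum[OF J_ideal]) auto
  have "h' \<noteq> 0"
    using p(2) \<open>h \<in> J\<close> q_split by (auto simp: q_def a_def)
  have comp_u: "homog_comp ?u a (homog_comp ?w c q) = homog_comp ?w c q" for c
    unfolding q_def by (rule poly_mapping_eqI) (auto simp: lookup_homog_comp when_def)
  have hu: "homog_comp ?u a h = h"
    unfolding h_def homog_comp_sum comp_u ..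
  have "h \<in> graded_init_ideal ?u I"
    using \<open>h \<in> J\<close> J by simp
  then obtain g where "g \<in> I" "g \<in> weight_ge ?u a" "homog_comp ?u a g = homog_comp ?u a h"
    by (rule graded_init_idealE)
  with hu(1) have g: "g \<in> I" "g \<in> weight_ge ?u a" "homog_comp ?u a g = h"
    by simp_all
  define p' where "p' = p - g"
  have \<pi>p': "\<pi> p' = f"
    using p(1) g(1) by (simp add: p'_def \<pi>_diff in_I_iff)
  have in_p': "homog_comp ?u a p' = h'"
    using q_split g(3) by (simp add: p'_def homog_comp_diff q_def)
  have ge: "p' \<in> weight_ge ?u a"
    unfolding p'_def a_def using g(2) by (intro weight_ge_diff pol_qval_in_weight_ge) (simp add: a_def)
  define m where "m = pol_qval ?w p'"
  have "p' \<noteq> 0"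
    using in_p' \<open>h' \<noteq> 0\<close> by auto
  have m_eq: "Poly_Mapping.lookup m (Min UNIV) = a"
  proof (rule antisym)
    obtain \<beta> where "\<beta> \<in> Poly_Mapping.keys h'"
      using \<open>h' \<noteq> 0\<close> by (metis keys_eq_empty ex_in_conv)
    then have \<beta>: "\<beta> \<in> Poly_Mapping.keys p'" "?u \<beta> = a"
      unfolding in_p'[symmetric] by (simp_all add: keys_homog_comp)
    then have "m \<le> ?w \<beta>"
      using pol_qval_in_weight_ge[of p' ?w] by (simp add: m_def weight_ge_def)
    from le_lexD[OF this] show "Poly_Mapping.lookup m (Min UNIV) \<le> a"
      by (simp add: u \<beta>(2))
    obtain \<alpha> where "\<alpha> \<in> Poly_Mapping.keys p'" "m = ?w \<alpha>"
      using pol_qval_in_image[OF \<open>p' \<noteq> 0\<close>, of ?w] unfolding m_def by blast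
    then show "a \<le> Poly_Mapping.lookup m (Min UNIV)"
      using ge by (simp add: u weight_ge_def)
  qed
  have "homog_comp ?w m p' = homog_comp ?w m (homog_comp ?u a p')"
    by (rule poly_mapping_eqI) (auto simp: lookup_homog_comp when_def u[symmetric] m_eq)
  then have eq: "homog_comp ?w m p' = homog_comp ?w m h'"
    by (simp add: in_p')
  have nz: "homog_comp ?w m p' \<noteq> 0"
    unfolding m_def using \<open>p' \<noteq> 0\<close> by (rule homog_comp_pol_qval_neq_0)
  have "homog_comp ?w m h' = (if m \<in> {c\<in>T. homog_comp ?w c q \<notin> J} then homog_comp ?w m q else 0)"
    unfolding h'_def using \<open>finite T\<close>
    by (simp add: homog_comp_sum homog_comp_homog_comp when_def sum.delta)
  with nz eq have "homog_comp ?w m p' \<notin> J"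
    by (auto split: if_splits)
  with \<pi>p' show ?thesis
    unfolding m_def by blast
qed

section \<open>The valuation of a prime initial ideal\<close>

text \<open>
  What a prime cone provides, both for one of its vectors and for a matrix of its vectors.
\<close>

locale prime_weight = presented_algebra smul b + additive_weight w
  for smul :: "'k::field \<Rightarrow> 'a::idom \<Rightarrow> 'a" and b :: "'n::finite \<Rightarrow> 'a"
    and w :: "'n expo \<Rightarrow> 'g::linordered_ab_group_add" +
  assumes prime: "primeideal (graded_init_ideal w I) mpol_ring"
    and no_monomial: "monomial \<alpha> \<notin> graded_init_ideal w I"
    and detecting_representative:
      "f \<noteq> 0 \<Longrightarrow> \<exists>p. \<pi> p = f \<and> homog_comp w (pol_qval w p) p \<notin> graded_init_ideal w I"
begin

abbreviation J :: "('n, 'k) mpol set" where "J \<equiv> graded_init_ideal w I"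
abbreviation v :: "'a \<Rightarrow> 'g" where "v \<equiv> weight_qval smul b w"

lemma J_ideal: "ideal J mpol_ring"
  by (rule graded_init_ideal_ideal[OF I_ideal])

lemma zero_in_J: "0 \<in> J"
  by (rule is_ideal_zero[OF J_ideal])

lemma J_prime: "p * q \<in> J \<Longrightarrow> p \<in> J \<or> q \<in> J"
  using primeideal.I_prime[OF prime, of p q] by (simp add: ring_of_type_algebra_def)

lemma init_form_of_relation: "p \<in> I \<Longrightarrow> p \<in> weight_ge w a \<Longrightarrow> homog_comp w a p \<in> J"
  by (rule homog_comp_graded_init_idealI[OF I_ideal])

lemma detecting_imp_nonzero:
  assumes "p \<in> weight_ge w a" "homog_comp w a p \<notin> J"
  shows "\<pi> p \<noteq> 0"
  using assms init_form_of_relation in_I_iff by blast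

text \<open>
  If \<open>q\<close> represented the same element with larger weight, then the initial form of the
  relation \<open>p - q\<close> would be that of \<open>p\<close>.
\<close>

lemma detecting_optimal:
  assumes p: "p \<in> weight_ge w a" "homog_comp w a p \<notin> J" and q: "\<pi> q = \<pi> p"
  shows "pol_qval w q \<le> a"
proof (rule ccontr)
  assume "\<not> ?thesis"
  moreover have "q \<noteq> 0"
    using detecting_imp_nonzero[OF p] q by auto
  ultimately have gt: "q \<in> weight_gt w a"
    by (simp add: weight_gt_iff_pol_qval)
  have "homog_comp w a (p - q) \<in> J"
    using p(1) q weight_gt_imp_ge[OF gt]
    by (intro init_form_of_relation weight_ge_diff) (auto simp: in_I_iff \<pi>_diff)
  with p(2) show False
    by (simp add: homog_comp_diff homog_comp_weight_gt[OF gt])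
qed

lemma weight_qval_eq:
  assumes p: "p \<in> weight_ge w a" "homog_comp w a p \<notin> J"
  shows "v (\<pi> p) = a"
  unfolding weight_qval_def
proof (rule Greatest_equality)
  have "homog_comp w a p \<noteq> 0"
    using p(2) zero_in_J by auto
  with p(1) have "pol_qval w p = a"
    by (rule pol_qval_eqI)
  then show "\<exists>q. \<pi> q = \<pi> p \<and> a = pol_qval w q" by metis
qed (use detecting_optimal[OF p] in auto)

lemma weight_qval_representative:
  assumes "f \<noteq> 0"
  obtains p where "\<pi> p = f" "p \<in> weight_ge w (v f)" "homog_comp w (v f) p \<notin> J"
proof -
  obtain p where p: "\<pi> p = f" "homog_comp w (pol_qval w p) p \<notin> J"
    using detecting_representative[OF assms] by blast
  with weight_qval_eq[OF pol_qval_in_weight_ge p(2)] that[of p] pol_qval_in_weight_ge[of p w]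
  show ?thesis by simp
qed

lemma weight_qval_defined: "weight_qval_defined smul b w"
  unfolding weight_qval_defined_def
proof (intro allI impI)
  fix f :: 'a assume "f \<noteq> 0"
  then obtain p where p: "\<pi> p = f" "homog_comp w (pol_qval w p) p \<notin> J"
    using detecting_representative by blast
  then show "\<exists>p. \<pi> p = f \<and> (\<forall>q. \<pi> q = f \<longrightarrow> pol_qval w q \<le> pol_qval w p)"
    using detecting_optimal[OF pol_qval_in_weight_ge p(2)] by auto
qed

lemma weight_qval_ge:
  assumes "q \<in> weight_ge w a" "\<pi> q \<noteq> 0"
  shows "a \<le> v (\<pi> q)"
proof -
  obtain p where p: "\<pi> p = \<pi> q" "p \<in> weight_ge w (v (\<pi> q))" "homog_comp w (v (\<pi> q)) p \<notin> J"
    using weight_qval_representative[OF assms(2)] .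
  have "a \<le> pol_qval w q"
    using assms by (subst weight_ge_iff_pol_qval[symmetric]) auto
  also have "\<dots> \<le> v (\<pi> q)"
    using detecting_optimal[OF p(2,3), of q] p(1) by simp
  finally show ?thesis .
qed

text \<open>
  The filtration of the valuation is the image of the weight filtration of the polynomial ring. The
  filtration steps therefore inherit their additive and multiplicative closure from polynomials.
\<close>

lemma filt_ge_eq: "filt_ge v a = \<pi> ` weight_ge w a"
proof
  show "filt_ge v a \<subseteq> \<pi> ` weight_ge w a"
  proof
    fix f assume f: "f \<in> filt_ge v a"
    show "f \<in> \<pi> ` weight_ge w a"
    proof (cases "f = 0")
      case True
      then show ?thesis by (intro image_eqI[of _ _ 0]) auto
    next
      case False
      then obtain p where "\<pi> p = f" "p \<in> weight_ge w (v f)"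
        by (rule weight_qval_representative)
      with f False show ?thesis
        by (auto simp: filt_ge_def intro: weight_ge_mono)
    qed
  qed
  show "\<pi> ` weight_ge w a \<subseteq> filt_ge v a"
    using weight_qval_ge by (auto simp: filt_ge_def)
qed

lemma filt_gt_eq: "filt_gt v a = \<pi> ` weight_gt w a"
proof
  show "filt_gt v a \<subseteq> \<pi> ` weight_gt w a"
  proof
    fix f assume f: "f \<in> filt_gt v a"
    show "f \<in> \<pi> ` weight_gt w a"
    proof (cases "f = 0")
      case True
      then show ?thesis by (intro image_eqI[of _ _ 0]) auto
    next
      case False
      then obtain p where "\<pi> p = f" "p \<in> weight_ge w (v f)"
        by (rule weight_qval_representative)
      with f False show ?thesis
        by (auto simp: filt_gt_def intro: weight_ge_imp_gt)
    qed
  qed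
  show "\<pi> ` weight_gt w a \<subseteq> filt_gt v a"
  proof clarify
    fix p :: "('n, 'k) mpol" assume p: "p \<in> weight_gt w a"
    show "\<pi> p \<in> filt_gt v a"
    proof (cases "\<pi> p = 0")
      case False
      then have "p \<noteq> 0" by auto
      then have "a < pol_qval w p"
        using p by (simp add: weight_gt_iff_pol_qval)
      also have "\<dots> \<le> v (\<pi> p)"
        using False pol_qval_in_weight_ge by (intro weight_qval_ge)
      finally show ?thesis
        using False by (simp add: filt_gt_def)
    qed (simp add: filt_gt_def)
  qed
qed

lemma in_filt_ge_iff: "f \<noteq> 0 \<Longrightarrow> f \<in> filt_ge v a \<longleftrightarrow> a \<le> v f"
  by (simp add: filt_ge_def)

lemma filt_gt_mult: "f \<in> filt_gt v a \<Longrightarrow> g \<in> filt_ge v c \<Longrightarrow> f * g \<in> filt_gt v (a + c)"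
  unfolding filt_gt_eq filt_ge_eq by (auto simp flip: \<pi>_mult intro!: imageI weight_gt_mult_ge)

lemma filt_ge_add: "f \<in> filt_ge v a \<Longrightarrow> g \<in> filt_ge v a \<Longrightarrow> f + g \<in> filt_ge v a"
  unfolding filt_ge_eq by (auto simp flip: \<pi>_add intro!: imageI weight_ge_add)

lemma filt_gt_add: "f \<in> filt_gt v a \<Longrightarrow> g \<in> filt_gt v a \<Longrightarrow> f + g \<in> filt_gt v a"
  unfolding filt_gt_eq by (auto simp flip: \<pi>_add intro!: imageI weight_gt_add)

lemma filt_gt_diff: "f \<in> filt_gt v a \<Longrightarrow> g \<in> filt_gt v a \<Longrightarrow> f - g \<in> filt_gt v a"
  unfolding filt_gt_eq by (auto simp flip: \<pi>_diff intro!: imageI weight_gt_diff)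

lemma zero_in_filt [simp]: "0 \<in> filt_ge v a" "0 \<in> filt_gt v a"
  by (simp_all add: filt_ge_def filt_gt_def)

lemma filt_gt_subset_ge: "filt_gt v a \<subseteq> filt_ge v a"
  by (auto simp: filt_ge_def filt_gt_def)

lemma filt_ge_smul:
  assumes "f \<in> filt_ge v a"
  shows "smul c f \<in> filt_ge v a"
proof -
  have "const_pol c \<in> weight_ge w 0"
    by (rule single_in_weight_ge) (simp add: w_zero)
  then have "const_pol c * p \<in> weight_ge w a" if "p \<in> weight_ge w a" for p
    using weight_ge_mult[of "const_pol c" 0 p a] that by simp
  with assms show ?thesis
    unfolding filt_ge_eq by (auto simp flip: \<pi>_const intro!: imageI)
qed

text \<open>
  The product of two detecting representatives is detecting, because its initial form is the product
  of theirs and \<open>J\<close> is prime.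
\<close>

lemma weight_qval_mult:
  assumes "f \<noteq> 0" "g \<noteq> 0"
  shows "v (f * g) = v f + v g"
proof -
  obtain p where p: "\<pi> p = f" "p \<in> weight_ge w (v f)" "homog_comp w (v f) p \<notin> J"
    using weight_qval_representative[OF assms(1)] .
  obtain q where q: "\<pi> q = g" "q \<in> weight_ge w (v g)" "homog_comp w (v g) q \<notin> J"
    using weight_qval_representative[OF assms(2)] .
  have "v (\<pi> (p * q)) = v f + v g"
    using p q J_prime by (intro weight_qval_eq weight_ge_mult) (auto simp: homog_comp_mult)
  then show ?thesis
    by (simp add: \<pi>_mult p(1) q(1))
qed

lemma valuation: "valuation smul v"
  unfolding valuation_def quasivaluation_def
proof (intro conjI allI impI; elim conjE)
  fix f g :: 'a assume nz: "f \<noteq> 0" "g \<noteq> 0" "f + g \<noteq> 0"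
  then have "f \<in> filt_ge v (min (v f) (v g))" "g \<in> filt_ge v (min (v f) (v g))"
    by (simp_all add: in_filt_ge_iff)
  then have "f + g \<in> filt_ge v (min (v f) (v g))"
    by (rule filt_ge_add)
  with nz(3) show "min (v f) (v g) \<le> v (f + g)"
    by (simp add: in_filt_ge_iff)
next
  fix c :: 'k and f :: 'a assume nz: "c \<noteq> 0" "f \<noteq> 0"
  then have nz': "smul c f \<noteq> 0"
    by simp
  have "v f \<le> v (smul c f)"
    using filt_ge_smul[of f "v f" c] nz' nz(2) by (simp add: in_filt_ge_iff)
  moreover have "v (smul c f) \<le> v (smul (inverse c) (smul c f))"
    using filt_ge_smul[of "smul c f" "v (smul c f)" "inverse c"] nz' nz by (simp add: in_filt_ge_iff)
  ultimately show "v (smul c f) = v f"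
    using nz by simp
qed (simp_all add: weight_qval_mult)

lemma weight_qval_monomial: "v (\<pi> (monomial \<alpha>)) = w \<alpha>"
  using no_monomial by (intro weight_qval_eq single_in_weight_ge) (simp_all add: homog_comp_single)

lemma monomial_nonzero: "\<pi> (monomial \<alpha>) \<noteq> 0"
  using no_monomial
  by (intro detecting_imp_nonzero[of _ "w \<alpha>"] single_in_weight_ge) (simp_all add: homog_comp_single)

text \<open>
  The value of \<open>f\<close> is the weight of some term of a detecting representative;
  conversely a monomial detects itself, since \<open>J\<close> contains no monomial.
\<close>

lemma value_semigroup_eq_range: "value_semigroup v = range w"
proof
  show "value_semigroup v \<subseteq> range w"
  proof
    fix a assume "a \<in> value_semigroup v"
    then obtain f where f: "f \<noteq> 0" "a = v f"
      by (auto simp: value_semigroup_def)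
    then obtain p where "homog_comp w a p \<notin> J"
      using weight_qval_representative by metis
    then have "homog_comp w a p \<noteq> 0"
      using zero_in_J by auto
    then have "a \<in> w ` Poly_Mapping.keys p"
      by (rule contrapos_np) (rule homog_comp_eq_0)
    then show "a \<in> range w" by blast
  qed
  have "w \<alpha> \<in> value_semigroup v" for \<alpha>
    unfolding value_semigroup_def
    by (intro CollectI exI[of _ "\<pi> (monomial \<alpha>)"] conjI weight_qval_monomial[symmetric] monomial_nonzero)
  then show "range w \<subseteq> value_semigroup v" by blast
qed

end

lemma (in additive_weight) range_eq_hull:
  "range w = add_submonoid hull (range (\<lambda>j. w (Poly_Mapping.single j 1)))"
proof
  let ?G = "range (\<lambda>j. w (Poly_Mapping.single j 1))"
  have "add_submonoid (add_submonoid hull ?G)"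
    by (rule hull_in) (auto simp: add_submonoid_def)
  note sub = this[unfolded add_submonoid_def[of "add_submonoid hull ?G"]]
  have hull_zero: "0 \<in> add_submonoid hull ?G"
    using sub by (rule conjunct1)
  have hull_add: "x + y \<in> add_submonoid hull ?G"
    if "x \<in> add_submonoid hull ?G" "y \<in> add_submonoid hull ?G" for x y
    using conjunct2[OF sub, rule_format, OF that] .
  have gen: "w (Poly_Mapping.single j k) \<in> add_submonoid hull ?G" for j k
  proof (induction k)
    case 0
    show ?case using hull_zero by (simp add: w_zero)
  next
    case (Suc k)
    have "w (Poly_Mapping.single j (Suc k)) = w (Poly_Mapping.single j k) + w (Poly_Mapping.single j 1)"
      by (simp flip: w_add single_add)
    moreover have "w (Poly_Mapping.single j 1) \<in> add_submonoid hull ?G"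
      by (rule hull_inc) auto
    ultimately show ?case
      using hull_add[OF Suc] by simp
  qed
  have sums: "w (\<Sum>j\<in>S. Poly_Mapping.single j (k j)) \<in> add_submonoid hull ?G" if "finite S" for S k
    using that
  proof (induction S)
    case empty
    show ?case using hull_zero by (simp add: w_zero)
  next
    case (insert j S)
    then show ?case
      using hull_add[OF gen insert.IH, of j "k j"] by (simp add: w_add)
  qed
  have "w \<alpha> \<in> add_submonoid hull ?G" for \<alpha>
    using sums[OF finite_keys[of \<alpha>], of "Poly_Mapping.lookup \<alpha>"]
    by (simp only: mpol_expand[symmetric])
  then show "range w \<subseteq> add_submonoid hull ?G" by blast
  show "add_submonoid hull ?G \<subseteq> range w"
  proof (rule hull_minimal)
    show "add_submonoid (range w)"
      unfolding add_submonoid_def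
    proof (intro conjI ballI)
      show "0 \<in> range w"
        using rangeI[of w 0] by (simp add: w_zero)
      fix x y assume "x \<in> range w" "y \<in> range w"
      then obtain \<alpha> \<beta> where "x = w \<alpha>" "y = w \<beta>" by blast
      then show "x + y \<in> range w"
        using rangeI[of w "\<alpha> + \<beta>"] by (simp add: w_add)
    qed
  qed auto
qed

section \<open>The associated graded ring\<close>

context prime_weight
begin

text \<open>
  The class in the associated graded ring of a polynomial, taken component by component. It is
  a surjective homomorphism with kernel \<open>J\<close>, and the isomorphism sends an element of
  the graded ring to its fibre.
\<close>

abbreviation gr_class :: "('n, 'k) mpol \<Rightarrow> 'g \<Rightarrow> 'a set" where
  "gr_class p \<equiv> \<lambda>a. \<pi> (homog_comp w a p) +o filt_gt v a"

lemma filt_gt_plus: "filt_gt v a + filt_gt v a = filt_gt v a"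
  by (auto simp: set_plus_def intro: filt_gt_add) (metis add_0 zero_in_filt(2))

lemma coset_eq_iff: "f +o filt_gt v a = g +o filt_gt v a \<longleftrightarrow> f - g \<in> filt_gt v a"
proof
  assume "f +o filt_gt v a = g +o filt_gt v a"
  moreover have "f \<in> f +o filt_gt v a"
    by (auto simp: elt_set_plus_def intro: bexI[of _ 0])
  ultimately show "f - g \<in> filt_gt v a"
    by (simp add: set_minus_plus)
next
  assume fg: "f - g \<in> filt_gt v a"
  have "g - f \<in> filt_gt v a"
    using filt_gt_diff[OF zero_in_filt(2) fg] by simp
  have "z - f \<in> filt_gt v a \<longleftrightarrow> z - g \<in> filt_gt v a" for z
    using filt_gt_add[OF _ fg, of "z - f"] filt_gt_add[OF _ \<open>g - f \<in> filt_gt v a\<close>, of "z - g"] by auto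
  then show "f +o filt_gt v a = g +o filt_gt v a"
    by (auto simp flip: set_minus_plus)
qed

lemma coset_eq_filt_iff: "f +o filt_gt v a = filt_gt v a \<longleftrightarrow> f \<in> filt_gt v a"
  using coset_eq_iff[of f a 0] by simp

text \<open>
  The component of weight \<open>a\<close> maps into \<open>filt_gt v a\<close> if and only if it
  agrees modulo \<open>I\<close> with a polynomial \<open>s\<close> of larger weight. The difference
  is then an element of \<open>I\<close> with the given initial part, so this is membership in the
  graded initial ideal.
\<close>

lemma gr_class_kernel: "gr_class p = gr_class q \<longleftrightarrow> p - q \<in> J"
proof -
  have "\<pi> (homog_comp w a r) \<in> filt_gt v a \<longleftrightarrow>
      (\<exists>g\<in>I. g \<in> weight_ge w a \<and> homog_comp w a g = homog_comp w a r)" for a r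
  proof
    assume "\<pi> (homog_comp w a r) \<in> filt_gt v a"
    then obtain s where s: "s \<in> weight_gt w a" "\<pi> (homog_comp w a r) = \<pi> s"
      unfolding filt_gt_eq by blast
    then show "\<exists>g\<in>I. g \<in> weight_ge w a \<and> homog_comp w a g = homog_comp w a r"
      by (intro bexI[of _ "homog_comp w a r - s"])
        (auto simp: homog_comp_diff homog_comp_homog_comp homog_comp_weight_gt in_I_iff \<pi>_diff
          intro: weight_ge_diff homog_comp_in_weight_ge weight_gt_imp_ge)
  next
    assume "\<exists>g\<in>I. g \<in> weight_ge w a \<and> homog_comp w a g = homog_comp w a r"
    then obtain g where g: "g \<in> I" "g \<in> weight_ge w a" "homog_comp w a g = homog_comp w a r" by blast
    have "\<pi> (0 - (g - homog_comp w a g)) \<in> filt_gt v a"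
      unfolding filt_gt_eq
      using weight_gt_diff[OF weight_gt_zero weight_gt_minus_homog_comp[OF g(2)]] by (rule imageI)
    with g show "\<pi> (homog_comp w a r) \<in> filt_gt v a"
      by (simp add: \<pi>_diff in_I_iff)
  qed
  then show ?thesis
    by (simp add: fun_eq_iff coset_eq_iff graded_init_ideal_def flip: \<pi>_diff homog_comp_diff)
qed

lemma gr_class_eq_zero_iff: "gr_class p a = filt_gt v a \<longleftrightarrow> \<pi> (homog_comp w a p) \<in> filt_gt v a"
  by (rule coset_eq_filt_iff)

lemma gr_class_support: "gr_class p a \<noteq> filt_gt v a \<Longrightarrow> a \<in> w ` Poly_Mapping.keys p"
proof (rule ccontr)
  assume "gr_class p a \<noteq> filt_gt v a" "a \<notin> w ` Poly_Mapping.keys p"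
  then show False
    by (simp add: homog_comp_eq_0)
qed

lemma gr_class_carrier: "gr_class p \<in> carrier (assoc_graded v)"
proof -
  have "finite {a. gr_class p a \<noteq> filt_gt v a}"
    by (rule finite_subset[of _ "w ` Poly_Mapping.keys p"]) (use gr_class_support in auto)
  moreover have "\<pi> (homog_comp w a p) \<in> filt_ge v a" for a
    unfolding filt_ge_eq by (intro imageI homog_comp_in_weight_ge)
  ultimately show ?thesis
    unfolding assoc_graded_def by auto
qed

lemma gr_class_surj:
  assumes "\<xi> \<in> carrier (assoc_graded v)"
  obtains p where "\<xi> = gr_class p"
proof -
  define S where "S = {a. \<xi> a \<noteq> filt_gt v a}"
  have "\<forall>a. \<exists>f\<in>filt_ge v a. \<xi> a = f +o filt_gt v a" and S: "finite S"
    using assms by (auto simp: assoc_graded_def S_def)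
  then have "\<forall>a. \<exists>p\<in>weight_ge w a. \<xi> a = \<pi> p +o filt_gt v a"
    unfolding filt_ge_eq by blast
  then obtain P where P: "\<And>a. P a \<in> weight_ge w a" "\<And>a. \<xi> a = \<pi> (P a) +o filt_gt v a"
    by metis
  define p where "p = (\<Sum>a\<in>S. homog_comp w a (P a))"
  have "\<xi> a = gr_class p a" for a
  proof (cases "a \<in> S")
    case True
    have "homog_comp w a p = (\<Sum>c\<in>S. if c = a then homog_comp w c (P c) else 0)"
      unfolding p_def homog_comp_sum by (intro sum.cong) (auto simp: homog_comp_homog_comp)
    also have "\<dots> = homog_comp w a (P a)"
      using True S by simp
    finally have "\<pi> (P a) - \<pi> (homog_comp w a p) = \<pi> (P a - homog_comp w a (P a))"
      by (simp add: \<pi>_diff)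
    also have "\<dots> \<in> filt_gt v a"
      unfolding filt_gt_eq by (intro imageI weight_gt_minus_homog_comp P(1))
    finally show ?thesis
      by (simp add: P(2) coset_eq_iff)
  next
    case False
    have "homog_comp w a p = 0"
      unfolding p_def homog_comp_sum using False by (intro sum.neutral) (auto simp: homog_comp_homog_comp when_def)
    with False show ?thesis by (simp add: S_def)
  qed
  with that show ?thesis by blast
qed

lemma gr_class_add: "gr_class p \<oplus>\<^bsub>assoc_graded v\<^esub> gr_class q = gr_class (p + q)"
  by (simp add: assoc_graded_def homog_comp_add \<pi>_add set_plus_rearrange filt_gt_plus)

lemma homog_comp_const: "homog_comp w a (const_pol c) = (if a = 0 then const_pol c else 0)"
  by (auto simp: homog_comp_single w_zero)

lemma gr_class_const: "gr_class (const_pol c) = graded_const smul v c"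
  by (simp add: graded_const_def fun_eq_iff homog_comp_const \<pi>_single)

lemma gr_class_one: "\<one>\<^bsub>assoc_graded v\<^esub> = gr_class 1"
  using gr_class_const[of 1] by (simp add: assoc_graded_def graded_const_def cong: if_cong)

text \<open>
  The elementwise sum of subsets of cosets is completed to a full coset by one summand
  \<open>filt_gt v c\<close>.
\<close>

lemma sum_cosets:
  assumes "finite S" "\<And>s. s \<in> S \<Longrightarrow> x s \<in> Y s" "\<And>s. s \<in> S \<Longrightarrow> Y s \<subseteq> x s +o filt_gt v c"
  shows "sum Y S + filt_gt v c = sum x S +o filt_gt v c"
  using assms
proof (induction S)
  case empty
  show ?case by simp
next
  case (insert s S)
  have IH: "sum Y S + filt_gt v c = sum x S +o filt_gt v c"
    using insert by auto
  have "Y s + filt_gt v c = x s +o filt_gt v c"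
  proof
    have "Y s + filt_gt v c \<subseteq> (x s +o filt_gt v c) + filt_gt v c"
      using insert.prems(2)[of s] by (intro set_plus_mono2) auto
    then show "Y s + filt_gt v c \<subseteq> x s +o filt_gt v c"
      by (simp add: set_plus_rearrange3 filt_gt_plus)
    show "x s +o filt_gt v c \<subseteq> Y s + filt_gt v c"
      using insert.prems(1)[of s] by (intro set_plus_mono3) auto
  qed
  then have "(Y s + filt_gt v c) + (sum Y S + filt_gt v c) = (x s + sum x S) +o filt_gt v c"
    using IH by (simp add: set_plus_rearrange filt_gt_plus)
  moreover have "(Y s + filt_gt v c) + (sum Y S + filt_gt v c)
      = (Y s + sum Y S) + (filt_gt v c + filt_gt v c)"
    by (simp only: ac_simps)
  ultimately show ?case
    using insert.hyps by (simp add: filt_gt_plus)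
qed

lemma coset_mult_subset:
  assumes f: "f \<in> filt_ge v a" and g: "g \<in> filt_ge v d"
  shows "(f +o filt_gt v a) * (g +o filt_gt v d) \<subseteq> f * g +o filt_gt v (a + d)"
proof
  fix z assume "z \<in> (f +o filt_gt v a) * (g +o filt_gt v d)"
  then obtain s t where s: "s \<in> filt_gt v a" and t: "t \<in> filt_gt v d" and z: "z = (f + s) * (g + t)"
    by (auto simp: set_times_def elt_set_plus_def)
  have "s * g + (t * f + s * t) \<in> filt_gt v (a + d)"
    using filt_gt_mult[OF s g] filt_gt_mult[OF t f] filt_gt_mult[OF s, of t d] t filt_gt_subset_ge[of d]
    by (intro filt_gt_add) (auto simp: add.commute)
  moreover have "z - f * g = s * g + (t * f + s * t)"
    by (simp add: z algebra_simps)
  ultimately show "z \<in> f * g +o filt_gt v (a + d)"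
    by (simp flip: set_minus_plus)
qed

lemma homog_comp_times:
  assumes "finite S" "finite T" "w ` Poly_Mapping.keys p \<subseteq> S" "w ` Poly_Mapping.keys q \<subseteq> T"
  shows "homog_comp w c (p * q) =
    (\<Sum>(a, d)\<in>{(a, d)\<in>S \<times> T. a + d = c}. homog_comp w a p * homog_comp w d q)"
proof -
  have "p * q = (\<Sum>a\<in>S. homog_comp w a p) * (\<Sum>d\<in>T. homog_comp w d q)"
    using assms by (simp add: sum_homog_comp)
  also have "\<dots> = (\<Sum>(a, d)\<in>S \<times> T. homog_comp w a p * homog_comp w d q)"
    by (simp add: sum_product sum.cartesian_product)
  finally have "homog_comp w c (p * q) =
      (\<Sum>(a, d)\<in>S \<times> T. homog_comp w c (homog_comp w a p * homog_comp w d q))"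
    by (simp add: homog_comp_sum case_prod_unfold)
  also have "\<dots> = (\<Sum>(a, d)\<in>S \<times> T. if a + d = c then homog_comp w a p * homog_comp w d q else 0)"
    by (intro sum.cong) (auto simp: homog_comp_mult_homogeneous)
  also have "\<dots> = (\<Sum>(a, d)\<in>{(a, d)\<in>S \<times> T. a + d = c}. homog_comp w a p * homog_comp w d q)"
    using assms(1,2) by (intro sum.mono_neutral_cong_right) (auto split: prod.splits)
  finally show ?thesis .
qed

text \<open>
  The product in the associated graded ring only runs over pairs of nonzero cosets, whereas the
  component of \<open>p * q\<close> runs over all pairs of weights that occur. The pairs in the
  difference contribute elements of \<open>filt_gt v c\<close>, which vanish in the coset.
\<close>

lemma gr_class_mult: "gr_class p \<otimes>\<^bsub>assoc_graded v\<^esub> gr_class q = gr_class (p * q)"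
proof
  fix c
  let ?S = "w ` Poly_Mapping.keys p" and ?T = "w ` Poly_Mapping.keys q"
  let ?D = "{(a, d)\<in>?S \<times> ?T. a + d = c}"
  let ?D' = "{(a, d). gr_class p a \<noteq> filt_gt v a \<and> gr_class q d \<noteq> filt_gt v d \<and> a + d = c}"
  let ?x = "\<lambda>(a, d). \<pi> (homog_comp w a p) * \<pi> (homog_comp w d q)"
  have fin: "finite ?D"
    by (rule finite_subset[of _ "?S \<times> ?T"]) auto
  have sub: "?D' \<subseteq> ?D"
    using gr_class_support by blast
  have ge: "\<pi> (homog_comp w a r) \<in> filt_ge v a" for a r
    unfolding filt_ge_eq by (intro imageI homog_comp_in_weight_ge)
  have self: "f \<in> f +o filt_gt v a" for f a
    by (auto simp: elt_set_plus_def intro: bexI[of _ 0])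
  have "(gr_class p \<otimes>\<^bsub>assoc_graded v\<^esub> gr_class q) c
      = (\<Sum>(a, d)\<in>?D'. gr_class p a * gr_class q d) + filt_gt v c"
    by (simp add: assoc_graded_def)
  also have "\<dots> = (\<Sum>s\<in>?D'. ?x s) +o filt_gt v c"
    using finite_subset[OF sub fin]
  proof (rule sum_cosets)
    fix s assume s: "s \<in> ?D'"
    then obtain a d where ad: "s = (a, d)" "a + d = c" by auto
    show "?x s \<in> (case s of (a, d) \<Rightarrow> gr_class p a * gr_class q d)"
      unfolding ad using self by (auto intro: set_times_intro)
    show "(case s of (a, d) \<Rightarrow> gr_class p a * gr_class q d) \<subseteq> ?x s +o filt_gt v c"
      using coset_mult_subset[OF ge ge, of a p d q] by (simp add: ad)
  qed
  also have "\<dots> = (\<Sum>s\<in>?D. ?x s) +o filt_gt v c"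
  proof -
    have "?x s \<in> filt_gt v c" if "s \<in> ?D - ?D'" for s
    proof -
      obtain a d where s: "s = (a, d)" by (cases s)
      with that have "a + d = c"
        "\<pi> (homog_comp w a p) \<in> filt_gt v a \<or> \<pi> (homog_comp w d q) \<in> filt_gt v d"
        by (simp_all add: gr_class_eq_zero_iff) blast
      with s show ?thesis
        using filt_gt_mult[OF _ ge, of "\<pi> (homog_comp w a p)" a d q]
          filt_gt_mult[OF _ ge, of "\<pi> (homog_comp w d q)" d a p]
        by (auto simp: ac_simps)
    qed
    moreover have "sum f Y \<in> filt_gt v c" if "\<And>s. s \<in> Y \<Longrightarrow> f s \<in> filt_gt v c"
      for f and Y :: "('g \<times> 'g) set"
      using that by (induction Y rule: infinite_finite_induct) (auto intro: filt_gt_add)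
    ultimately have "sum ?x (?D - ?D') \<in> filt_gt v c" by blast
    moreover have "sum ?x ?D - sum ?x ?D' = sum ?x (?D - ?D')"
      using fin sub by (simp add: sum_diff)
    ultimately show ?thesis
      by (subst eq_commute, subst coset_eq_iff) simp
  qed
  also have "(\<Sum>s\<in>?D. ?x s) = \<pi> (homog_comp w c (p * q))"
    by (subst homog_comp_times[of ?S ?T]) (auto simp: \<pi>_sum \<pi>_mult case_prod_unfold)
  finally show "(gr_class p \<otimes>\<^bsub>assoc_graded v\<^esub> gr_class q) c = gr_class (p * q) c" .
qed

lemma assoc_graded_iso:
  "\<exists>h \<in> ring_iso (assoc_graded v) (mpol_ring Quot J).
     \<forall>c. h (graded_const smul v c) = J +>\<^bsub>mpol_ring\<^esub> const_pol c"
proof -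
  interpret J: ideal J mpol_ring by (rule J_ideal)
  define h where "h \<xi> = {p. gr_class p = \<xi>}" for \<xi>
  have h: "h (gr_class p) = J +>\<^bsub>mpol_ring\<^esub> p" for p
    unfolding h_def coset_ring_of_type_algebra gr_class_kernel ..
  have carrier_mpol: "p \<in> carrier mpol_ring" for p :: "('n, 'k) mpol"
    by (simp add: ring_of_type_algebra_def)
  have Quot_carrier: "carrier (mpol_ring Quot J) = range (\<lambda>p. J +>\<^bsub>mpol_ring\<^esub> p)"
    using carrier_mpol by (auto simp: FactRing_def A_RCOSETS_def')
  have "h \<in> ring_iso (assoc_graded v) (mpol_ring Quot J)"
  proof (rule ring_iso_memI)
    fix \<xi> assume "\<xi> \<in> carrier (assoc_graded v)"
    then obtain p where p: "\<xi> = gr_class p" by (rule gr_class_surj)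
    show "h \<xi> \<in> carrier (mpol_ring Quot J)"
      by (simp add: p h Quot_carrier)
    fix \<eta> assume "\<eta> \<in> carrier (assoc_graded v)"
    then obtain q where q: "\<eta> = gr_class q" by (rule gr_class_surj)
    show "h (\<xi> \<otimes>\<^bsub>assoc_graded v\<^esub> \<eta>) = h \<xi> \<otimes>\<^bsub>mpol_ring Quot J\<^esub> h \<eta>"
      unfolding p q gr_class_mult h
      using J.rcoset_mult_add[OF carrier_mpol carrier_mpol, of p q]
      by (simp add: FactRing_def) (simp add: ring_of_type_algebra_def)
    show "h (\<xi> \<oplus>\<^bsub>assoc_graded v\<^esub> \<eta>) = h \<xi> \<oplus>\<^bsub>mpol_ring Quot J\<^esub> h \<eta>"
      unfolding p q gr_class_add h
      using J.a_rcos_sum[OF carrier_mpol carrier_mpol, of p q]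
      by (simp add: FactRing_def) (simp add: ring_of_type_algebra_def)
  next
    show "h \<one>\<^bsub>assoc_graded v\<^esub> = \<one>\<^bsub>mpol_ring Quot J\<^esub>"
      unfolding gr_class_one h by (simp add: FactRing_def) (simp add: ring_of_type_algebra_def)
  next
    show "bij_betw h (carrier (assoc_graded v)) (carrier (mpol_ring Quot J))"
    proof (rule bij_betw_imageI)
      show "inj_on h (carrier (assoc_graded v))"
      proof (rule inj_onI)
        fix \<xi> \<eta> assume "\<xi> \<in> carrier (assoc_graded v)" and eq: "h \<xi> = h \<eta>"
        then obtain p where p: "\<xi> = gr_class p" by (elim gr_class_surj)
        then have "p \<in> h \<xi>" by (simp add: h_def)
        with eq p show "\<xi> = \<eta>" by (simp add: h_def)
      qed
      show "h ` carrier (assoc_graded v) = carrier (mpol_ring Quot J)"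
      proof
        show "h ` carrier (assoc_graded v) \<subseteq> carrier (mpol_ring Quot J)"
        proof (rule image_subsetI)
          fix \<xi> assume "\<xi> \<in> carrier (assoc_graded v)"
          then obtain p where "\<xi> = gr_class p" by (rule gr_class_surj)
          then show "h \<xi> \<in> carrier (mpol_ring Quot J)"
            by (simp only: h Quot_carrier rangeI)
        qed
        show "carrier (mpol_ring Quot J) \<subseteq> h ` carrier (assoc_graded v)"
          unfolding Quot_carrier h[symmetric]
          by (intro image_subsetI imageI gr_class_carrier)
      qed
    qed
  qed
  moreover have "h (graded_const smul v c) = J +>\<^bsub>mpol_ring\<^esub> const_pol c" for c
    by (simp only: h flip: gr_class_const)
  ultimately show ?thesis by blast
qed

end

section \<open>Standard monomials\<close>

lemma is_lead_single_mult:
  fixes g :: "('n, 'k::field) mpol"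
  assumes "monomial_ordering prec" "is_lead prec g \<delta>"
  shows "is_lead prec (Poly_Mapping.single \<gamma> 1 * g) (\<gamma> + \<delta>)"
  unfolding is_lead_def
proof (intro conjI ballI impI)
  show "\<gamma> + \<delta> \<in> Poly_Mapping.keys (Poly_Mapping.single \<gamma> 1 * g)"
    using assms(2) by (simp add: is_lead_def in_keys_iff lookup_single_mult)
  fix \<beta> assume "\<beta> \<in> Poly_Mapping.keys (Poly_Mapping.single \<gamma> 1 * g)" and ne: "\<beta> \<noteq> \<gamma> + \<delta>"
  then obtain \<epsilon> where \<epsilon>: "\<epsilon> \<in> Poly_Mapping.keys g" "\<beta> = \<gamma> + \<epsilon>"
    by (elim keys_single_mult)
  with ne assms(2) have "prec \<epsilon> \<delta>"
    by (auto simp: is_lead_def)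
  from monomial_ordering_add[OF assms(1) this, of \<gamma>] show "prec \<beta> (\<gamma> + \<delta>)"
    by (simp add: \<epsilon>(2) add.commute)
qed

text \<open>
  The polynomials whose exponents are all leading exponents of elements of \<open>K\<close> form an
  ideal, since multiplying by a monomial shifts leading exponents.
\<close>

lemma monomial_in_lead_ideal_iff:
  fixes K :: "('n, 'k::field) mpol set"
  assumes ord: "monomial_ordering prec" and K: "ideal K mpol_ring"
  shows "monomial \<alpha> \<in> lead_ideal prec K \<longleftrightarrow> (\<exists>g\<in>K. is_lead prec g \<alpha>)"
proof
  define L :: "('n, 'k) mpol set" where "L = {p. \<forall>\<alpha>\<in>Poly_Mapping.keys p. \<exists>g\<in>K. is_lead prec g \<alpha>}"
  have L: "ideal L mpol_ring"
    unfolding ideal_ring_of_type_algebra_iff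
  proof (intro conjI ballI allI)
    show "0 \<in> L" by (simp add: L_def)
  next
    fix p q assume "p \<in> L" "q \<in> L"
    then show "p + q \<in> L"
      using keys_add[of p q] by (auto simp: L_def)
  next
    fix p r assume p: "p \<in> L"
    show "r * p \<in> L"
      unfolding L_def
    proof (intro CollectI ballI)
      fix \<beta> assume "\<beta> \<in> Poly_Mapping.keys (r * p)"
      then obtain \<gamma> \<delta> where \<delta>: "\<beta> = \<gamma> + \<delta>" "\<delta> \<in> Poly_Mapping.keys p"
        using keys_mult[of r p] by blast
      with p obtain g where "g \<in> K" "is_lead prec g \<delta>"
        by (auto simp: L_def)
      then show "\<exists>g\<in>K. is_lead prec g \<beta>"
        using is_lead_single_mult[OF ord, of g \<delta> \<gamma>] is_ideal_mult[OF K] \<delta>(1) by blast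
    qed
  qed
  have "lead_term prec p \<in> L" if "p \<in> K" for p
  proof (cases "p = 0")
    case True
    then show ?thesis by (simp add: lead_term_def L_def)
  next
    case False
    then obtain \<alpha> where "is_lead prec p \<alpha>"
      using is_lead_exists[OF ord] by blast
    with that show ?thesis
      by (auto simp: lead_term_eq[OF ord] L_def)
  qed
  then have "lead_ideal prec K \<subseteq> L"
    unfolding lead_ideal_def by (intro genideal_ring_of_type_algebra(3) L) auto
  then show "\<exists>g\<in>K. is_lead prec g \<alpha>" if "monomial \<alpha> \<in> lead_ideal prec K"
    using that by (auto simp: L_def)
next
  assume "\<exists>g\<in>K. is_lead prec g \<alpha>"
  then obtain g where g: "g \<in> K" "is_lead prec g \<alpha>" by blast
  have "Poly_Mapping.single \<alpha> (Poly_Mapping.lookup g \<alpha>) \<in> lead_ideal prec K"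
    using genideal_ring_of_type_algebra(2)[of "lead_term prec ` K"] g(1)
      lead_term_eq[OF ord g(2)] unfolding lead_ideal_def by force
  then have "const_pol (inverse (Poly_Mapping.lookup g \<alpha>))
      * Poly_Mapping.single \<alpha> (Poly_Mapping.lookup g \<alpha>) \<in> lead_ideal prec K"
    unfolding lead_ideal_def by (rule is_ideal_mult[OF genideal_ring_of_type_algebra(1)])
  moreover have "Poly_Mapping.lookup g \<alpha> \<noteq> 0"
    using g(2) by (simp add: is_lead_def in_keys_iff)
  ultimately show "monomial \<alpha> \<in> lead_ideal prec K"
    by (simp add: mult_single)
qed

text \<open>
  Polynomials in normal form with respect to \<open>K\<close>.
\<close>

definition standard_pol ::
  "('n expo \<Rightarrow> 'n expo \<Rightarrow> bool) \<Rightarrow> ('n, 'k::field) mpol set \<Rightarrow> ('n, 'k) mpol set" where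
  "standard_pol prec K =
     {s. \<forall>\<alpha>\<in>Poly_Mapping.keys s. (monomial \<alpha> :: ('n, 'k) mpol) \<notin> lead_ideal prec K}"

lemma standard_pol_Int_ideal:
  assumes ord: "monomial_ordering prec" and K: "ideal K mpol_ring"
    and s: "s \<in> standard_pol prec K" "s \<in> K"
  shows "s = 0"
proof (rule ccontr)
  assume "s \<noteq> 0"
  then obtain \<alpha> where \<alpha>: "is_lead prec s \<alpha>"
    using is_lead_exists[OF ord] by blast
  with s(2) have "monomial \<alpha> \<in> lead_ideal prec K"
    using monomial_in_lead_ideal_iff[OF ord K] by blast
  with s(1) \<alpha> show False
    by (auto simp: standard_pol_def is_lead_def)
qed

context presented_algebra
begin

text \<open>
  By well-founded induction every monomial is congruent to a combination of standard ones: a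
  monomial that is not standard is the leading monomial of a relation, which rewrites it into
  smaller monomials.
\<close>

lemma standard_representative:
  assumes ord: "monomial_ordering prec"
  shows "\<exists>s\<in>standard_pol prec I. \<pi> s = f"
proof -
  define V where "V = \<pi> ` standard_pol prec I"
  have "0 \<in> V"
    unfolding V_def by (rule image_eqI[of _ _ 0]) (simp_all add: standard_pol_def)
  have V_add: "x + y \<in> V" if xy: "x \<in> V" "y \<in> V" for x y
  proof -
    obtain s t where "x = \<pi> s" "y = \<pi> t" "s \<in> standard_pol prec I" "t \<in> standard_pol prec I"
      using xy unfolding V_def by blast
    moreover from this have "s + t \<in> standard_pol prec I"
      using keys_add[of s t] by (auto simp: standard_pol_def)
    ultimately show ?thesis
      unfolding V_def by (intro image_eqI[of _ _ "s + t"]) (simp_all add: \<pi>_add)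
  qed
  have V_smul: "smul c x \<in> V" if x: "x \<in> V" for c x
  proof -
    obtain s where "x = \<pi> s" "s \<in> standard_pol prec I"
      using x unfolding V_def by blast
    moreover from this have "const_pol c * s \<in> standard_pol prec I"
      by (auto simp: standard_pol_def elim!: keys_single_mult)
    ultimately show ?thesis
      unfolding V_def by (intro image_eqI[of _ _ "const_pol c * s"]) (simp_all add: \<pi>_const)
  qed
  have V_\<pi>: "\<pi> p \<in> V" if p: "\<And>\<alpha>. \<alpha> \<in> Poly_Mapping.keys p \<Longrightarrow> \<pi> (monomial \<alpha>) \<in> V" for p
  proof -
    have "(\<Sum>\<alpha>\<in>S. smul (Poly_Mapping.lookup p \<alpha>) (\<pi> (monomial \<alpha>))) \<in> V"
      if "finite S" "S \<subseteq> Poly_Mapping.keys p" for S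
      using that
      by (induction S) (simp_all add: \<open>0 \<in> V\<close> V_add V_smul p)
    from this[OF finite_keys order_refl] show ?thesis
      by (simp only: \<pi>_expand[of p])
  qed
  have mono: "\<pi> (monomial \<alpha>) \<in> V" for \<alpha>
  proof (induction \<alpha> rule: wfp_induct_rule[OF monomial_ordering_wfp[OF ord]])
    case (1 \<alpha>)
    show ?case
    proof (cases "(monomial \<alpha> :: ('n, 'k) mpol) \<in> lead_ideal prec I")
      case False
      then show ?thesis
        unfolding V_def by (intro imageI) (simp add: standard_pol_def)
    next
      case True
      then obtain g where g: "g \<in> I" "is_lead prec g \<alpha>"
        using monomial_in_lead_ideal_iff[OF ord I_ideal] by blast
      define r where "r = monomial \<alpha> - Poly_Mapping.single 0 (1 / Poly_Mapping.lookup g \<alpha>) * g"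
      have less: "prec \<beta> \<alpha>" if "\<beta> \<in> Poly_Mapping.keys r" for \<beta>
        using lead_cancel[OF ord, of "monomial \<alpha>" 0 \<alpha> g \<beta>] g(2) that
        by (simp add: r_def is_lead_def)
      have "\<pi> r \<in> V"
        by (rule V_\<pi>) (rule 1[OF less])
      moreover have "\<pi> r = \<pi> (monomial \<alpha>)"
        using g(1) by (simp add: r_def \<pi>_diff \<pi>_mult in_I_iff)
      ultimately show ?thesis by simp
    qed
  qed
  obtain p where "\<pi> p = f"
    using \<pi>_surj by blast
  moreover have "\<pi> p \<in> V"
    by (rule V_\<pi>) (rule mono)
  ultimately have "f \<in> \<pi> ` standard_pol prec I"
    by (simp add: V_def)
  then show ?thesis
    by (auto elim!: imageE)
qed

lemma standard_monomials_eq: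
  "standard_monomials smul b prec =
    {\<pi> (monomial \<alpha>) | \<alpha>. (monomial \<alpha> :: ('n, 'k) mpol) \<notin> lead_ideal prec I}"
  by (simp add: standard_monomials_def)

text \<open>
  Lifting a linear dependence to polynomials gives a combination of standard monomials in
  \<open>I\<close>. Distinct elements lift to distinct exponents, so no coefficient is lost.
\<close>

lemma independent_standard_monomials:
  assumes ord: "monomial_ordering prec"
  shows "independent (standard_monomials smul b prec)"
proof
  assume "dependent (standard_monomials smul b prec)"
  then obtain T c x where T: "finite T" "T \<subseteq> standard_monomials smul b prec"
    and sum0: "(\<Sum>y\<in>T. smul (c y) y) = 0" and x: "x \<in> T" "c x \<noteq> 0"
    unfolding dependent_explicit by blast
  have "\<forall>y\<in>T. \<exists>\<alpha>. \<pi> (monomial \<alpha>) = y \<and> (monomial \<alpha> :: ('n, 'k) mpol) \<notin> lead_ideal prec I"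
    using T(2) unfolding standard_monomials_eq by blast
  from bchoice[OF this] obtain e where e: "\<And>y. y \<in> T \<Longrightarrow> \<pi> (monomial (e y)) = y"
    "\<And>y. y \<in> T \<Longrightarrow> (monomial (e y) :: ('n, 'k) mpol) \<notin> lead_ideal prec I"
    by auto
  define s where "s = (\<Sum>y\<in>T. Poly_Mapping.single (e y) (c y))"
  have "Poly_Mapping.keys s \<subseteq> e ` T"
    unfolding s_def by (rule order_trans[OF keys_sum]) auto
  then have "s \<in> standard_pol prec I"
    using e(2) by (auto simp: standard_pol_def)
  moreover have "\<pi> (Poly_Mapping.single (e y) (c y)) = smul (c y) y" if "y \<in> T" for y
    using \<pi>_const[of "c y" "monomial (e y)"] e(1)[OF that] by (simp add: mult_single)
  then have "s \<in> I"
    using sum0 by (simp add: s_def \<pi>_sum in_I_iff)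
  ultimately have "s = 0"
    using standard_pol_Int_ideal[OF ord I_ideal] by blast
  have inj: "y = x" if "y \<in> T" "e y = e x" for y
  proof -
    have "\<pi> (monomial (e y)) = \<pi> (monomial (e x))"
      by (simp only: that(2))
    then show ?thesis
      by (simp only: e(1)[OF that(1)] e(1)[OF x(1)])
  qed
  have "Poly_Mapping.lookup s (e x) = (\<Sum>y\<in>T. c y when y = x)"
    unfolding s_def lookup_sum by (intro sum.cong) (auto simp: lookup_single when_def dest: inj)
  also have "\<dots> = c x"
    using T(1) x(1) by (simp add: when_def)
  finally show False
    using x(2) \<open>s = 0\<close> by simp
qed

end

context prime_weight
begin

text \<open>
  Monomials that are standard for \<open>I\<close> are standard for \<open>J\<close>. So the initial
  form of a nonzero combination \<open>s\<close> of standard monomials is such a combination again and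
  lies outside \<open>J\<close>: the normal form of every element detects its value. An element
  of \<open>filt_ge v a\<close> is therefore a combination of standard monomials that all lie in
  \<open>filt_ge v a\<close>.
\<close>

lemma adapted_basis_standard_monomials:
  assumes ord: "monomial_ordering prec" and lead: "lead_ideal prec J = lead_ideal prec I"
  shows "adapted_basis smul v (standard_monomials smul b prec)"
proof -
  let ?B = "standard_monomials smul b prec"
  have standard_ge: "s \<in> weight_ge w a" if s: "s \<in> standard_pol prec I" and f: "\<pi> s \<in> filt_ge v a" for s a
  proof (cases "s = 0")
    case False
    let ?m = "pol_qval w s"
    have "homog_comp w ?m s \<in> standard_pol prec J"
      using s by (auto simp: standard_pol_def lead keys_homog_comp)
    then have "homog_comp w ?m s \<notin> J"
      using standard_pol_Int_ideal[OF ord J_ideal] homog_comp_pol_qval_neq_0[OF False, of w] by blast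
    then have "v (\<pi> s) = ?m" "\<pi> s \<noteq> 0"
      using weight_qval_eq detecting_imp_nonzero pol_qval_in_weight_ge by blast+
    with f have "a \<le> ?m"
      by (simp add: in_filt_ge_iff)
    then show ?thesis
      by (rule weight_ge_mono[OF pol_qval_in_weight_ge])
  qed simp
  have span: "filt_ge v a \<subseteq> span (filt_ge v a \<inter> ?B)" for a
  proof
    fix f assume f: "f \<in> filt_ge v a"
    obtain s where s: "s \<in> standard_pol prec I" "\<pi> s = f"
      using standard_representative[OF ord] by blast
    with f have ge: "s \<in> weight_ge w a"
      using standard_ge by blast
    have "\<pi> (monomial \<alpha>) \<in> filt_ge v a \<inter> ?B" if \<alpha>: "\<alpha> \<in> Poly_Mapping.keys s" for \<alpha>
    proof
      show "\<pi> (monomial \<alpha>) \<in> filt_ge v a"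
        unfolding filt_ge_eq using ge \<alpha> by (intro imageI single_in_weight_ge) (simp add: weight_ge_def)
      show "\<pi> (monomial \<alpha>) \<in> ?B"
        using s(1) \<alpha> unfolding standard_monomials_eq standard_pol_def by blast
    qed
    then show "f \<in> span (filt_ge v a \<inter> ?B)"
      unfolding s(2)[symmetric] by (subst \<pi>_expand) (intro span_sum span_scale span_base)
  qed
  have sub: "subspace (filt_ge v a)" for a
    by (intro subspaceI zero_in_filt filt_ge_add filt_ge_smul)
  have "span (filt_ge v a \<inter> ?B) = filt_ge v a" for a
    using span[of a] span_minimal[OF _ sub, of "filt_ge v a \<inter> ?B" a] by blast
  moreover have "span ?B = UNIV"
  proof -
    have "f \<in> span ?B" for f
    proof (cases "f = 0")
      case False
      then have "f \<in> span (filt_ge v (v f) \<inter> ?B)"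
        using span[of "v f"] in_filt_ge_iff by blast
      then show ?thesis
        using span_mono[of "filt_ge v (v f) \<inter> ?B" ?B] by blast
    qed (simp add: span_zero)
    then show ?thesis by blast
  qed
  moreover have "independent ?B"
    by (rule independent_standard_monomials[OF ord])
  ultimately show ?thesis
    unfolding adapted_basis_def basis_of_def using independent_mono by blast
qed

end

section \<open>Prime cones\<close>

lemma cone_init_ideal_eq:
  assumes "open_cone I C" "u \<in> C"
  shows "init_ideal u I = cone_init_ideal C I"
proof -
  have "\<forall>x\<in>C. init_ideal x I = init_ideal u I"
    using assms unfolding open_cone_def by blast
  then have "(THE J. \<forall>x\<in>C. init_ideal x I = J) = init_ideal u I"
    by (rule the_equality) (use assms(2) in blast)
  then show ?thesis
    by (simp add: cone_init_ideal_def)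
qed

theorem theorem4:
  fixes smul :: "'k::field \<Rightarrow> 'a::idom \<Rightarrow> 'a"
    and b :: "'n::finite \<Rightarrow> 'a"
    and I :: "('n, 'k) mpol set"
    and C :: "(rat ^ 'n) set"
    and u :: "'r::{finite,linorder} \<Rightarrow> rat ^ 'n"
    and M :: "rat ^ 'n ^ 'r::{finite,linorder}"
    and v :: "'a \<Rightarrow> ('r \<Rightarrow>\<^sub>0 rat)"
  assumes alg: "k_algebra smul"
    and gen: "algebra_generators smul (range b)"
    and I: "I = kernel_ideal smul b"
    and C: "prime_cone I C"
    and u_in: "range u \<subseteq> C"
    and u_span: "int (dim (span (real_vec ` range u))) = aff_dim (real_vec ` C)"
    and M: "M = (\<chi> i. u i)"
    and v: "v = weight_qval smul b (mat_weight M)"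
  shows
    "weight_qval_defined smul b (mat_weight M) \<and> valuation smul v \<and>
     (\<exists>h \<in> ring_iso (assoc_graded v) (mpol_ring Quot cone_init_ideal C I).
        \<forall>c. h (graded_const smul v c) = cone_init_ideal C I +>\<^bsub>mpol_ring\<^esub> const_pol c) \<and>
     ((\<forall>j. b j \<noteq> 0) \<and> (\<forall>i. weight_qval_defined smul b (weight (u i))) \<and>
      M = (\<chi> i j. weight_qval smul b (weight (u i)) (b j))) \<and>
     value_semigroup v = add_submonoid hull (range (\<lambda>j. lex_vec (column j M))) \<and>
     (C \<subseteq> groebner_region I \<longrightarrow>
        (\<exists>prec. monomial_ordering prec \<and> C \<subseteq> groebner_cone prec I) \<and>
        (\<forall>prec. monomial_ordering prec \<and> C \<subseteq> groebner_cone prec I \<longrightarrow>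
           adapted_basis smul v (standard_monomials smul b prec)))"
proof -
  interpret A: presented_algebra smul b
    using alg gen by (simp add: presented_algebra_def presented_algebra_axioms_def)
  note I_ideal = A.I_ideal[folded I]
  define J where "J = cone_init_ideal C I"
  have cone: "open_cone I C" and prime: "primeideal J mpol_ring"
    using C by (auto simp: prime_cone_def J_def)
  have init: "init_ideal x I = J" if "x \<in> C" for x
    unfolding J_def by (rule cone_init_ideal_eq[OF cone that])
  have u_C: "u i \<in> C" for i
    using u_in by blast
  have no_monomial: "monomial \<alpha> \<notin> J" for \<alpha>
    using cone u_C[of undefined] init[OF u_C[of undefined]] unfolding open_cone_def trop_def by blast
  have proper: "1 \<notin> J"
    using no_monomial[of 0] by simp
  have J_u: "graded_init_ideal (weight (u i)) I = J" for i
    using init_ideal_eq_graded_init_ideal[OF I_ideal, of "u i"] init[OF u_C] by simp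
  have rows: "M $ i = u i" for i
    by (simp add: M)
  have J_M: "graded_init_ideal (mat_weight M) I = J"
    using graded_init_ideal_mat_weight[OF I_ideal, of M J] J_u by (simp add: rows)
  have prime_u: "prime_weight smul b (weight (u i))" for i
  proof (intro prime_weight.intro A.presented_algebra_axioms additive_weight_weight
      prime_weight_axioms.intro)
    fix f :: 'a assume "f \<noteq> 0"
    then show "\<exists>p. eval_hom smul b p = f \<and> homog_comp (weight (u i)) (pol_qval (weight (u i)) p) p
        \<notin> graded_init_ideal (weight (u i)) (kernel_ideal smul b)"
      using A.detecting_representative_weight[of "u i" f] proper J_u[of i] by (simp add: I)
  qed (use prime no_monomial J_u[of i] in \<open>simp_all add: I\<close>)
  interpret V: prime_weight smul b "mat_weight M"
  proof (intro prime_weight.intro A.presented_algebra_axioms additive_weight_mat_weight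
      prime_weight_axioms.intro)
    fix f :: 'a assume "f \<noteq> 0"
    then show "\<exists>p. eval_hom smul b p = f \<and> homog_comp (mat_weight M) (pol_qval (mat_weight M) p) p
        \<notin> graded_init_ideal (mat_weight M) (kernel_ideal smul b)"
      using A.detecting_representative_mat_weight[of M J f] proper J_u J_M by (simp add: I rows)
  qed (use prime no_monomial J_M in \<open>simp_all add: I\<close>)
  have V_J: "V.J = J"
    using J_M by (simp add: I)
  have nonzero: "b j \<noteq> 0" for j
    using V.monomial_nonzero[of "Poly_Mapping.single j 1"] unfolding A.\<pi>_var .
  have entries: "weight_qval smul b (weight (u i)) (b j) = u i $ j" for i j
  proof -
    have "weight_qval smul b (weight (u i)) (b j) = weight (u i) (Poly_Mapping.single j 1)"
      using prime_weight.weight_qval_monomial[OF prime_u, of i "Poly_Mapping.single j 1"]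
      by (simp only: A.\<pi>_var)
    also have "\<dots> = u i $ j"
    proof -
      have "u i $ k * of_nat (Poly_Mapping.lookup (Poly_Mapping.single j 1) k) = (if k = j then u i $ k else 0)" for k
        by (simp add: lookup_single when_def)
      then show ?thesis
        unfolding weight_alt by simp
    qed
    finally show ?thesis .
  qed
  have columns: "mat_weight M (Poly_Mapping.single j 1) = lex_vec (column j M)" for j
  proof -
    have "M $ i $ k * expo_vec (Poly_Mapping.single j 1) $ k = (if k = j then M $ i $ k else 0)" for i k
      by (simp add: expo_vec_def lookup_single when_def)
    then have "M *v expo_vec (Poly_Mapping.single j 1) = column j M"
      by (simp add: vec_eq_iff matrix_vector_mult_def column_def)
    then show ?thesis
      by (simp only: mat_weight_def)
  qed
  have semigroup: "value_semigroup v = add_submonoid hull (range (\<lambda>j. lex_vec (column j M)))"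
    using V.value_semigroup_eq_range V.range_eq_hull by (simp only: v columns)
  have ordering: "\<exists>prec. monomial_ordering prec \<and> C \<subseteq> groebner_cone prec I" if region: "C \<subseteq> groebner_region I"
  proof -
    obtain prec where prec: "monomial_ordering prec" "u undefined \<in> groebner_cone prec I"
      using region u_C[of undefined] unfolding groebner_region_def by blast
    then have "lead_ideal prec J = lead_ideal prec I"
      using init[OF u_C] by (simp add: groebner_cone_def)
    then have "C \<subseteq> groebner_cone prec I"
      using init by (auto simp: groebner_cone_def)
    with prec(1) show ?thesis by blast
  qed
  have adapted: "adapted_basis smul v (standard_monomials smul b prec)"
    if prec: "monomial_ordering prec" "C \<subseteq> groebner_cone prec I" for prec
  proof -
    have "lead_ideal prec J = lead_ideal prec I"
      using prec(2) u_C[of undefined] init[OF u_C[of undefined]] by (auto simp: groebner_cone_def)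
    then show ?thesis
      using V.adapted_basis_standard_monomials[OF prec(1)] unfolding v V_J I by blast
  qed
  have iso: "\<exists>h \<in> ring_iso (assoc_graded v) (mpol_ring Quot J).
      \<forall>c. h (graded_const smul v c) = J +>\<^bsub>mpol_ring\<^esub> const_pol c"
    using V.assoc_graded_iso unfolding v V_J .
  have matrix: "M = (\<chi> i j. weight_qval smul b (weight (u i)) (b j))"
    by (simp add: vec_eq_iff rows entries)
  show ?thesis
    unfolding J_def[symmetric]
    using V.weight_qval_defined V.valuation[folded v] iso nonzero
      prime_weight.weight_qval_defined[OF prime_u] matrix semigroup ordering adapted
    by blast
qed

end
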